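(* Let $S$ be a finite N-step set such that $\max_{s\in S}\min(s)\le0$, and such that the sets of reachable points of N-meanders on $S$ are described by finitely many types, i.e. there is a finite collection of types $\mathcal T(n_i,k_i,\mathbf a_i,\mathbf b_i,\mathbf c_i)$ such that the set of reachable points of every N-meander on $S$ belongs to one of them. Then the generating function of N-excursions on $S$ (by length) is algebraic.
   Context: An N-step is a non-empty finite set of integers. For a finite set $S$ of N-steps, an N-walk is a finite sequence $(s_1,\dots,s_n)$ of elements of $S$ starting at $0$. A classical walk $(v_1,\dots,v_n)$ with positions $\omega_k=\sum_{i\le k}v_i$ is compatible if $v_i\in s_i$ for all $i$; it is a meander if all $\omega_k\ge0$, an excursion if moreover $\omega_n=0$. An N-meander (resp. N-excursion) is an N-walk compatible with at least one meander (resp. excursion); its set of reachable points is the set of endpoints of all compatible meanders. For finite integer sets, $\mathbf s+\mathbf t=\{a+b:a\in\mathbf s,b\in\mathbf t\}$; for an integer $j\ge0$, $j\times\mathbf s$ is the $j$-fold sumset of $\mathbf s$ with itself ($0\times\mathbf s=\{0\}$). Bottom pruning: $\mathbf s\ominus\mathbf t=\emptyset$ if $\mathbf s=\emptyset$, else $\mathbf s\setminus(\{\min\mathbf s\}+\mathbf t)$. Top pruning: $\mathbf s\ominus'\mathbf t=\emptyset$ if $\mathbf s=\emptyset$, else $\mathbf s\setminus\{\max\mathbf s-b: b\in\mathbf t\}$. For integers $n,k\ge0$ and finite integer sets $\mathbf a,\mathbf b,\mathbf c$, the type is $\mathcal T(n,k,\mathbf a,\mathbf b,\mathbf c)=\{((j\times\{0,n\}+\mathbf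 b)\ominus\mathbf a)\ominus'\mathbf c+\{m\}: m\in\mathbb Z,\ j\in\mathbb Z_{\ge k}\}$. *)

theory Defs
  imports
    Complex_Main
    "HOL-Library.Set_Algebras"
    "HOL-Computational_Algebra.Computational_Algebra"
begin

text \<open>
  Sumsets are written with the addition on sets from \<^theory>\<open>HOL-Library.Set_Algebras\<close>.
  Walks are represented by the lists of their steps; the empty list is the walk of length 0.
\<close>

definition N_step :: "int set \<Rightarrow> bool" where
  "N_step s \<longleftrightarrow> finite s \<and> s \<noteq> {}"

definition N_walk :: "int set set \<Rightarrow> int set list \<Rightarrow> bool" where
  "N_walk S w \<longleftrightarrow> set w \<subseteq> S"

definition position :: "int list \<Rightarrow> nat \<Rightarrow> int" where
  "position v k = sum_list (take k v)"

definition meander :: "int list \<Rightarrow> bool" where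
  "meander v \<longleftrightarrow> (\<forall>k\<le>length v. position v k \<ge> 0)"

definition excursion :: "int list \<Rightarrow> bool" where
  "excursion v \<longleftrightarrow> meander v \<and> position v (length v) = 0"

definition compatible :: "int list \<Rightarrow> int set list \<Rightarrow> bool" where
  "compatible v w \<longleftrightarrow> list_all2 (\<in>) v w"

definition N_meander :: "int set set \<Rightarrow> int set list \<Rightarrow> bool" where
  "N_meander S w \<longleftrightarrow> N_walk S w \<and> (\<exists>v. compatible v w \<and> meander v)"

definition N_excursion :: "int set set \<Rightarrow> int set list \<Rightarrow> bool" where
  "N_excursion S w \<longleftrightarrow> N_walk S w \<and> (\<exists>v. compatible v w \<and> excursion v)"

definition reachable_points :: "int set list \<Rightarrow> int set" where
  "reachable_points w = {position v (length v) |v. compatible v w \<and> meander v}"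

primrec sumset_fold :: "nat \<Rightarrow> int set \<Rightarrow> int set" where
  "sumset_fold 0 s = {0}"
| "sumset_fold (Suc j) s = s + sumset_fold j s"

definition bottom_prune :: "int set \<Rightarrow> int set \<Rightarrow> int set" where
  "bottom_prune s t = (if s = {} then {} else s - ({Min s} + t))"

definition top_prune :: "int set \<Rightarrow> int set \<Rightarrow> int set" where
  "top_prune s t = (if s = {} then {} else s - {Max s - b |b. b \<in> t})"

definition reach_type :: "nat \<Rightarrow> nat \<Rightarrow> int set \<Rightarrow> int set \<Rightarrow> int set \<Rightarrow> int set set" where
  "reach_type n k a b c =
     {top_prune (bottom_prune (sumset_fold j {0, int n} + b) a) c + {m} |m j. k \<le> j}"

definition N_excursion_gf :: "int set set \<Rightarrow> rat fps" where
  "N_excursion_gf S = Abs_fps (\<lambda>n. of_nat (card {w. N_excursion S w \<and> length w = n}))"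

text \<open>
  A power series \<open>F(t)\<close> is algebraic if \<open>P(t, F(t)) = 0\<close> for some nonzero polynomial
  \<open>P(t, y)\<close>, here a polynomial in \<open>y\<close> whose coefficients are polynomials in \<open>t\<close>.
\<close>

definition algebraic_fps :: "'a::field fps \<Rightarrow> bool" where
  "algebraic_fps F \<longleftrightarrow> (\<exists>P :: 'a poly poly. P \<noteq> 0 \<and> poly (map_poly fps_of_poly P) F = 0)"

end

theory Submission
  imports Defs
begin

text \<open>
  A set belonging to finitely many types is periodic with bounded gaps away from its two ends,
  and its smallest element stays bounded because every step can go down (weakly). Hence a
  reachable set is determined by its intersection with a bounded window at the bottom, by a
  bounded window below its maximum, and by that maximum; when the maximum is large, the evolution
  of the windows does not depend on it. So the walks are run by a deterministic automaton with
  one counter, whose generating functions solve a quadratic polynomial system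
  \<open>y\<^sub>i = a\<^sub>i + t Q\<^sub>i(y)\<close>.

  The solution of such a system is algebraic: perturb it to
  \<open>y\<^sub>i = a\<^sub>i + t (Q\<^sub>i(y) + e y\<^sub>i\<^sup>3)\<close> with an indeterminate \<open>e\<close>. Solving for
  \<open>y\<^sub>i\<^sup>3\<close> shows that the monomials in the \<open>y\<^sub>i\<close> span a finite-dimensional space
  over the rational functions in \<open>e\<close> and \<open>t\<close>, so the powers of \<open>y\<^sub>i\<close> are linearly dependent. Divide
  the relation by the largest possible power of \<open>e\<close> and set \<open>e = 0\<close>.
\<close>

section \<open>Algebraicity of solutions of quadratic systems\<close>

text \<open>Fraction-free Gaussian elimination: the vectors outnumber the coordinates, and each
  round clears one coordinate by cross-multiplying with a pivot \<open>p\<close>, since an integral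
  domain has no division.\<close>

lemma linear_dependence_idom:
  fixes r :: "'m \<Rightarrow> 'e \<Rightarrow> 'a::idom"
  assumes "finite E" "finite M" "card E < card M"
  shows "\<exists>l. (\<exists>m\<in>M. l m \<noteq> 0) \<and> (\<forall>e\<in>E. (\<Sum>m\<in>M. l m * r m e) = 0)"
  using assms
proof (induction E arbitrary: M r rule: finite_induct)
  case empty
  then obtain m where "m \<in> M" by fastforce
  then show ?case by (intro exI[of _ "\<lambda>_. 1"]) auto
next
  case (insert e E)
  show ?case
  proof (cases "\<forall>m\<in>M. r m e = 0")
    case True
    have "card E < card M" using insert.prems insert.hyps by simp
    from insert.IH[OF insert.prems(1) this, of r] True show ?thesis by auto
  next
    case False
    then obtain p where p: "p \<in> M" "r p e \<noteq> 0" by blast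
    have "card E < card (M - {p})" using insert.prems insert.hyps p by simp
    from insert.IH[OF _ this, of "\<lambda>m x. r p e * r m x - r m e * r p x"] insert.prems(1)
    obtain l where l: "\<exists>m\<in>M-{p}. l m \<noteq> 0"
      "\<And>x. x \<in> E \<Longrightarrow> (\<Sum>m\<in>M-{p}. l m * (r p e * r m x - r m e * r p x)) = 0" by auto
    \<comment> \<open>The relation between the eliminated vectors, regrouped by the original ones.
      Coefficients other than that of \<open>p\<close> gain the nonzero factor \<open>r p e\<close>,
      so the relation stays nontrivial.\<close>
    define k where "k m = (if m = p then - (\<Sum>m\<in>M-{p}. l m * r m e) else r p e * l m)" for m
    have split: "(\<Sum>m\<in>M. k m * r m x) =
        - (\<Sum>m\<in>M-{p}. l m * r m e) * r p x + (\<Sum>m\<in>M-{p}. r p e * l m * r m x)" for x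
    proof -
      have "(\<Sum>m\<in>M. k m * r m x) = k p * r p x + (\<Sum>m\<in>M-{p}. k m * r m x)"
        using p insert.prems(1) by (simp add: sum.remove)
      also have "(\<Sum>m\<in>M-{p}. k m * r m x) = (\<Sum>m\<in>M-{p}. r p e * l m * r m x)"
        by (intro sum.cong) (auto simp: k_def)
      finally show ?thesis by (simp add: k_def)
    qed
    have "(\<Sum>m\<in>M. k m * r m x) = 0" if "x \<in> insert e E" for x
    proof (cases "x = e")
      case True
      then show ?thesis unfolding split by (simp add: sum_distrib_left algebra_simps)
    next
      case False
      then have "x \<in> E" using that by simp
      from l(2)[OF this] show ?thesis unfolding split
        by (simp add: sum_distrib_left sum_distrib_right sum_subtractf algebra_simps)
    qed
    moreover have "\<exists>m\<in>M. k m \<noteq> 0" using l(1) p by (auto simp: k_def)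
    ultimately show ?thesis by blast
  qed
qed

section \<open>Monomials in a finitely generated module\<close>

lemma finite_bounded_multisets:
  assumes "finite I"
  shows "finite {\<mu>. set_mset \<mu> \<subseteq> I \<and> (\<forall>i. count \<mu> i < (n::nat))}"
proof (rule inj_on_finite[where f = count])
  show "inj_on count {\<mu>. set_mset \<mu> \<subseteq> I \<and> (\<forall>i. count \<mu> i < n)}"
    by (auto simp: inj_on_def count_inject)
  show "count ` {\<mu>. set_mset \<mu> \<subseteq> I \<and> (\<forall>i. count \<mu> i < n)}
      \<subseteq> {f. \<forall>i. (i \<in> I \<longrightarrow> f i \<in> {..<n}) \<and> (i \<notin> I \<longrightarrow> f i = 0)}"
    by (auto simp: not_in_iff)
  show "finite {f. \<forall>i. (i \<in> I \<longrightarrow> f i \<in> {..<n}) \<and> (i \<notin> I \<longrightarrow> f i = 0)}"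
    by (intro finite_set_of_finite_funs assms) simp
qed

text \<open>Scalars are polynomials rather than rational functions; denominators are cleared by
  explicit multipliers.\<close>

interpretation fps_module: module "\<lambda>(r::'b::comm_ring_1 poly) f. fps_of_poly r * f"
  by unfold_locales (simp_all add: algebra_simps fps_of_poly_add fps_of_poly_mult)

text \<open>The exponents up to \<open>card B\<close> number one more than the generators, which
  forces a dependence over the polynomials; the nonzero multipliers \<open>c\<close> keep it
  nontrivial.\<close>

lemma finite_monomials_imp_algebraic:
  fixes Y :: "'b::idom fps"
  assumes "finite B" "\<And>m. \<exists>c. c \<noteq> 0 \<and> fps_of_poly c * Y ^ m \<in> fps_module.span B"
  shows "\<exists>N l. (\<exists>m\<le>N. l m \<noteq> 0) \<and> (\<Sum>m\<le>N. fps_of_poly (l m) * Y ^ m) = 0"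
proof -
  from assms(2) obtain c where c: "\<And>m. c m \<noteq> 0"
    "\<And>m. fps_of_poly (c m) * Y ^ m \<in> fps_module.span B" by metis
  have "\<exists>u. fps_of_poly (c m) * Y ^ m = (\<Sum>v\<in>B. fps_of_poly (u v) * v)" for m
    using c(2)[of m] unfolding fps_module.span_finite[OF assms(1)] by auto
  then obtain u where u: "\<And>m. fps_of_poly (c m) * Y ^ m = (\<Sum>v\<in>B. fps_of_poly (u m v) * v)"
    by metis
  obtain l where l: "\<exists>m\<in>{..card B}. l m \<noteq> 0"
    "\<And>e. e \<in> B \<Longrightarrow> (\<Sum>m\<le>card B. l m * u m e) = 0"
    using linear_dependence_idom[OF assms(1), of "{..card B}" u] by auto
  have "(\<Sum>m\<le>card B. fps_of_poly (l m * c m) * Y ^ m)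
      = (\<Sum>m\<le>card B. fps_of_poly (l m) * (\<Sum>v\<in>B. fps_of_poly (u m v) * v))"
    by (intro sum.cong) (auto simp: fps_of_poly_mult mult.assoc u)
  also have "\<dots> = (\<Sum>v\<in>B. \<Sum>m\<le>card B. fps_of_poly (l m) * (fps_of_poly (u m v) * v))"
    unfolding sum_distrib_left by (rule sum.swap)
  also have "\<dots> = (\<Sum>v\<in>B. fps_of_poly (\<Sum>m\<le>card B. l m * u m v) * v)"
    by (intro sum.cong refl) (simp only: fps_of_poly_sum fps_of_poly_mult sum_distrib_right mult.assoc)
  also have "\<dots> = 0" using l(2) by simp
  finally show ?thesis using l(1) c(1)
    by (intro exI[of _ "card B"] exI[of _ "\<lambda>m. l m * c m"]) auto
qed

text \<open>
  The cubic perturbation makes the leading forms of the system those of \<open>y\<^sub>i\<^sup>3\<close>, so that,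
  up to powers of \<open>e t\<close>, every monomial reduces to one of the finitely many whose exponents
  are below 3.
\<close>

lemma perturbed_system_algebraic:
  fixes y :: "'i \<Rightarrow> 'b::idom fps" and a :: "'i \<Rightarrow> 'b" and T :: "'i \<Rightarrow> ('i \<times> 'i) multiset"
  assumes "finite I" "e \<noteq> 0" and T: "\<And>i. i \<in> I \<Longrightarrow> set_mset (T i) \<subseteq> I \<times> I"
    and y: "\<And>i. i \<in> I \<Longrightarrow> y i = fps_const (a i) +
              fps_X * ((\<Sum>(j, k)\<in>#T i. y j * y k) + fps_const e * y i ^ 3)"
    and "i \<in> I"
  shows "\<exists>N l. (\<exists>m\<le>N. l m \<noteq> 0) \<and> (\<Sum>m\<le>N. fps_of_poly (l m) * y i ^ m) = 0"
proof -
  define Mon where "Mon \<mu> = (\<Prod>i\<in>#\<mu>. y i)" for \<mu>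
  define E where "E = {\<mu>. set_mset \<mu> \<subseteq> I \<and> (\<forall>i. count \<mu> i < 3)}"
  \<comment> \<open>The polynomial \<open>e t\<close>, the coefficient of \<open>y i ^ 3\<close> in
    each equation.\<close>
  define et where "et = [:0, e:]"
  have et: "fps_of_poly et = fps_X * fps_const e"
    by (simp add: et_def fps_of_poly_pCons fps_of_poly_const mult.commute)
  define sp where "sp = fps_module.span (Mon ` E)"
  have finE: "finite (Mon ` E)" unfolding E_def by (intro finite_imageI finite_bounded_multisets assms)
  have scale: "fps_of_poly c * f \<in> sp" if "f \<in> sp" for c f
    using that unfolding sp_def by (rule fps_module.span_scale)
  have pad: "fps_of_poly et ^ n * f \<in> sp" if "fps_of_poly et ^ m * f \<in> sp" "m \<le> n" for m n f
  proof -
    have "fps_of_poly et ^ n * f = fps_of_poly (et ^ (n - m)) * (fps_of_poly et ^ m * f)"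
    proof -
      have "fps_of_poly et ^ n = fps_of_poly et ^ (n - m) * fps_of_poly et ^ m"
        using that(2) by (simp flip: power_add)
      then show ?thesis by (simp only: fps_of_poly_power mult.assoc)
    qed
    then show ?thesis by (simp only: scale[OF that(1)])
  qed
  \<comment> \<open>One factor \<open>et\<close> per unit of degree suffices: rewriting a cube costs
    one factor and lowers the degree by at least one.\<close>
  have key: "fps_of_poly et ^ size \<mu> * Mon \<mu> \<in> sp" if "set_mset \<mu> \<subseteq> I" for \<mu>
    using that
  proof (induction "size \<mu>" arbitrary: \<mu> rule: less_induct)
    case less
    show ?case
    proof (cases "\<mu> \<in> E")
      case True
      then have "Mon \<mu> \<in> sp" unfolding sp_def by (intro fps_module.span_base) auto
      from scale[OF this, of "et ^ size \<mu>"] show ?thesis by (simp add: fps_of_poly_power)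
    next
      case False
      then obtain j where j: "count \<mu> j \<ge> 3" using less.prems unfolding E_def by (auto simp: not_less)
      then have "j \<in># \<mu>" by (simp flip: count_greater_zero_iff)
      then have jI: "j \<in> I" using less.prems by auto
      obtain \<nu> where nu: "\<mu> = \<nu> + {#j, j, j#}"
      proof -
        have "replicate_mset 3 j \<subseteq># \<mu>" using j by (simp add: count_le_replicate_mset_subset_eq)
        then have "{#j, j, j#} \<subseteq># \<mu>" by (simp add: numeral_3_eq_3)
        then show ?thesis using that by (auto simp: mset_subset_eq_exists_conv)
      qed
      have sz: "size \<mu> = size \<nu> + 3" by (simp add: nu)
      have nuI: "set_mset \<nu> \<subseteq> I" using less.prems nu by auto
      let ?s = "fps_of_poly et ^ (size \<nu> + 2)"
      define Q where "Q = (\<Sum>(k, l)\<in>#T j. y k * y l)"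
      have cube: "fps_of_poly et * y j ^ 3 = y j - fps_const (a j) - fps_X * Q"
      proof -
        have "y j = fps_const (a j) + (fps_X * Q + fps_X * fps_const e * y j ^ 3)"
          unfolding Q_def using y[OF jI] by (simp only: distrib_left mult.assoc)
        then show ?thesis unfolding et by (simp only: diff_eq_eq eq_diff_eq ac_simps)
      qed
      have "fps_of_poly et * Mon \<mu> = Mon \<nu> * (fps_of_poly et * y j ^ 3)"
        by (simp add: nu Mon_def power3_eq_cube algebra_simps)
      also have "\<dots> = Mon (\<nu> + {#j#}) - fps_const (a j) * Mon \<nu> -
           fps_X * (\<Sum>(k, l)\<in>#T j. Mon (\<nu> + {#k, l#}))"
      proof -
        have "Mon \<nu> * (\<Sum>(k, l)\<in>#T j. y k * y l) = (\<Sum>(k, l)\<in>#T j. Mon (\<nu> + {#k, l#}))"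
          unfolding sum_mset_distrib_left
          by (intro arg_cong[where f = sum_mset] image_mset_cong) (auto simp: Mon_def algebra_simps)
        moreover have "Mon (\<nu> + {#j#}) = Mon \<nu> * y j" by (simp add: Mon_def mult.commute)
        ultimately show ?thesis unfolding cube by (simp add: Q_def algebra_simps)
      qed
      finally have h: "fps_of_poly et * Mon \<mu> = Mon (\<nu> + {#j#}) - fps_const (a j) * Mon \<nu> -
           fps_X * (\<Sum>(k, l)\<in>#T j. Mon (\<nu> + {#k, l#}))" .
      have "fps_of_poly et ^ size \<mu> * Mon \<mu> = ?s * (fps_of_poly et * Mon \<mu>)"
        by (simp add: sz eval_nat_numeral ac_simps del: fps_of_poly_mult)
      then have eq: "fps_of_poly et ^ size \<mu> * Mon \<mu> = ?s * Mon (\<nu> + {#j#}) -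
          fps_of_poly [:a j:] * (?s * Mon \<nu>) -
          fps_of_poly [:0, 1:] * (?s * (\<Sum>(k, l)\<in>#T j. Mon (\<nu> + {#k, l#})))" (is "_ = ?A - ?B - ?C")
        unfolding h fps_of_poly_const fps_of_poly_fps_X right_diff_distrib
        by (simp only: mult.left_commute)
      have small: "?s * Mon \<rho> \<in> sp" if "set_mset \<rho> \<subseteq> I" "size \<rho> \<le> size \<nu> + 2" for \<rho>
        using pad[OF less.hyps[of \<rho>] that(2)] that sz by auto
      have "?A \<in> sp" using nuI jI by (intro small) auto
      moreover have "?B \<in> sp" using nuI by (intro scale small) auto
      moreover have "?C \<in> sp"
      proof (rule scale)
        have "?s * (\<Sum>(k, l)\<in>#U. Mon (\<nu> + {#k, l#})) \<in> sp" if "set_mset U \<subseteq> I \<times> I" for U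
          using that
        proof (induction U)
          case empty then show ?case by (simp add: sp_def fps_module.span_zero)
        next
          case (add x U)
          obtain k l where x: "x = (k, l)" by fastforce
          have "?s * Mon (\<nu> + {#k, l#}) \<in> sp" using nuI add.prems x by (intro small) auto
          with add show ?case unfolding sp_def
            by (auto simp: x distrib_left intro!: fps_module.span_add)
        qed
        from this[OF T[OF jI]] show "?s * (\<Sum>(k, l)\<in>#T j. Mon (\<nu> + {#k, l#})) \<in> sp" .
      qed
      ultimately show ?thesis unfolding eq sp_def by (intro fps_module.span_diff)
    qed
  qed
  show ?thesis
  proof (rule finite_monomials_imp_algebraic[OF finE])
    fix m
    have "fps_of_poly (et ^ m) * y i ^ m \<in> sp"
      using key[of "replicate_mset m i"] \<open>i \<in> I\<close>
      by (auto simp: Mon_def fps_of_poly_power split: if_splits)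
    moreover have "et ^ m \<noteq> 0" using assms(2) by (simp add: et_def)
    ultimately show "\<exists>c. c \<noteq> 0 \<and> fps_of_poly c * y i ^ m \<in> fps_module.span (Mon ` E)"
      unfolding sp_def by blast
  qed
qed

section \<open>The substitution \<open>e = 0\<close> in coefficients that are polynomials in
  \<open>e\<close>\<close>

definition specialize :: "'b::comm_ring_1 poly fps \<Rightarrow> 'b fps" where
  "specialize f = Abs_fps (\<lambda>n. coeff (f $ n) 0)"

lemma specialize_nth [simp]: "specialize f $ n = coeff (f $ n) 0"
  by (simp add: specialize_def)

lemma specialize_0 [simp]: "specialize 0 = 0"
  and specialize_1 [simp]: "specialize 1 = 1"
  and specialize_add: "specialize (f + g) = specialize f + specialize g"
  by (rule fps_ext; simp)+

lemma specialize_const [simp]: "specialize (fps_const c) = fps_const (coeff c 0)"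
  by (rule fps_ext) simp

lemma specialize_X [simp]: "specialize fps_X = fps_X"
  by (rule fps_ext) (simp add: fps_X_def)

lemma specialize_mult: "specialize (f * g) = specialize f * specialize g"
  by (rule fps_ext) (simp add: fps_mult_nth coeff_sum coeff_mult_0)

lemma specialize_power: "specialize (f ^ n) = specialize f ^ n"
  by (induction n) (simp_all add: specialize_mult)

lemma specialize_sum: "specialize (sum f A) = (\<Sum>x\<in>A. specialize (f x))"
  by (induction A rule: infinite_finite_induct) (simp_all add: specialize_add)

lemma specialize_sum_mset: "specialize (\<Sum>x\<in>#A. f x) = (\<Sum>x\<in>#A. specialize (f x))"
  by (induction A) (simp_all add: specialize_add)

lemma specialize_fps_of_poly:
  "specialize (fps_of_poly p) = fps_of_poly (map_poly (\<lambda>c. coeff c 0) p)"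
  by (rule fps_ext) (simp add: coeff_map_poly)

text \<open>Putting \<open>e = 0\<close> may kill every coefficient. Then \<open>e\<close> divides
  them all and can be cancelled, which lowers the degree in \<open>e\<close> of a fixed nonzero
  coefficient, so the process stops.\<close>

lemma specialize_algebraic:
  fixes Y :: "'b::idom poly fps" and l :: "nat \<Rightarrow> 'b poly poly"
  assumes "\<exists>m\<le>N. l m \<noteq> 0" "(\<Sum>m\<le>N. fps_of_poly (l m) * Y ^ m) = 0"
  shows "\<exists>l'. (\<exists>m\<le>N. l' m \<noteq> 0) \<and> (\<Sum>m\<le>N. fps_of_poly (l' m) * specialize Y ^ m) = 0"
proof -
  obtain m0 where "m0 \<le> N" "l m0 \<noteq> 0" using assms(1) by blast
  moreover define j0 where "j0 = degree (l m0)"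
  ultimately have "m0 \<le> N" "coeff (l m0) j0 \<noteq> 0" by simp_all
  then show ?thesis using assms(2)
  proof (induction "degree (coeff (l m0) j0)" arbitrary: l rule: less_induct)
    case less
    show ?case
    proof (cases "\<exists>m\<le>N. map_poly (\<lambda>c. coeff c 0) (l m) \<noteq> 0")
      case True
      have "(\<Sum>m\<le>N. fps_of_poly (map_poly (\<lambda>c. coeff c 0) (l m)) * specialize Y ^ m) = 0"
        using arg_cong[OF less.prems(3), of specialize]
        unfolding specialize_sum specialize_mult specialize_power specialize_fps_of_poly specialize_0 .
      with True show ?thesis by (intro exI[of _ "\<lambda>m. map_poly (\<lambda>c. coeff c 0) (l m)"] conjI)
    next
      case False
      \<comment> \<open>\<open>poly_shift 1\<close> is division by \<open>e\<close>, exact here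
        because the constant terms in \<open>e\<close> vanish.\<close>
      define l1 where "l1 m = map_poly (poly_shift 1) (l m)" for m
      have l1: "l m = smult [:0, 1:] (l1 m)" if "m \<le> N" for m
      proof (rule poly_eqI)
        fix j
        have "coeff (map_poly (\<lambda>c. coeff c 0) (l m)) j = 0" using False that by simp
        then have "coeff (coeff (l m) j) 0 = 0" by (simp add: coeff_map_poly)
        then have "coeff (l m) j = pCons 0 (poly_shift 1 (coeff (l m) j))"
          by (intro poly_eqI) (simp add: coeff_pCons coeff_poly_shift split: nat.splits)
        then show "coeff (l m) j = coeff (smult [:0, 1:] (l1 m)) j"
          by (simp add: l1_def coeff_map_poly)
      qed
      have c: "coeff (l m0) j0 = pCons 0 (coeff (l1 m0) j0)"
        using l1[OF less.prems(1)] by simp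
      with less.prems(2) have nz: "coeff (l1 m0) j0 \<noteq> 0" by auto
      have "fps_const [:0, 1:] * (\<Sum>m\<le>N. fps_of_poly (l1 m) * Y ^ m) =
          (\<Sum>m\<le>N. fps_of_poly (l m) * Y ^ m)"
        unfolding sum_distrib_left
      proof (intro sum.cong refl)
        fix m assume "m \<in> {..N}"
        then have "fps_of_poly (l m) = fps_const [:0, 1:] * fps_of_poly (l1 m)"
          using l1[of m] by (simp add: fps_of_poly_smult)
        then show "fps_const [:0, 1:] * (fps_of_poly (l1 m) * Y ^ m) = fps_of_poly (l m) * Y ^ m"
          by (simp only: mult.assoc)
      qed
      then have "(\<Sum>m\<le>N. fps_of_poly (l1 m) * Y ^ m) = 0"
        using less.prems(3) by (simp add: fps_const_nonzero_eq_nonzero)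
      from less.hyps[OF _ less.prems(1) nz this] c nz show ?thesis by simp
    qed
  qed
qed

section \<open>Existence of a solution by iteration\<close>

definition system_map ::
  "'b \<Rightarrow> ('i \<Rightarrow> 'b) \<Rightarrow> ('i \<Rightarrow> ('i \<times> 'i) multiset) \<Rightarrow> ('i \<Rightarrow> 'b::comm_ring_1 fps) \<Rightarrow> 'i \<Rightarrow> 'b fps"
where
  "system_map e a T y i =
     fps_const (a i) + fps_X * ((\<Sum>(j, k)\<in>#T i. y j * y k) + fps_const e * y i ^ 3)"

lemma fps_cutoff_mult_cong:
  fixes f g f' g' :: "'b::comm_ring_1 fps"
  assumes "fps_cutoff n f = fps_cutoff n f'" "fps_cutoff n g = fps_cutoff n g'"
  shows "fps_cutoff n (f * g) = fps_cutoff n (f' * g')"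
proof (rule fps_ext)
  have nth: "f $ m = f' $ m" "g $ m = g' $ m" if "m < n" for m
    using assms that unfolding fps_eq_iff fps_cutoff_nth by (metis)+
  fix m
  show "fps_cutoff n (f * g) $ m = fps_cutoff n (f' * g') $ m"
    by (auto simp: fps_mult_nth nth intro!: sum.cong)
qed

lemma fps_cutoff_add_cong:
  fixes f g f' g' :: "'b::comm_ring_1 fps"
  assumes "fps_cutoff n f = fps_cutoff n f'" "fps_cutoff n g = fps_cutoff n g'"
  shows "fps_cutoff n (f + g) = fps_cutoff n (f' + g')"
  using assms by (simp add: fps_cutoff_add)

text \<open>The factor \<open>fps_X\<close> makes the map a contraction in the \<open>t\<close>-adic
  metric: each application gains one coefficient of agreement.\<close>

lemma system_map_cutoff:
  assumes "\<And>i. fps_cutoff n (x i) = fps_cutoff n (y i)"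
  shows "fps_cutoff (Suc n) (system_map e a T x i) = fps_cutoff (Suc n) (system_map e a T y i)"
proof -
  have sums: "fps_cutoff n (\<Sum>(j, k)\<in>#U. x j * x k) = fps_cutoff n (\<Sum>(j, k)\<in>#U. y j * y k)" for U
    by (induction U) (auto intro!: fps_cutoff_add_cong fps_cutoff_mult_cong assms)
  have "fps_cutoff n ((\<Sum>(j, k)\<in>#T i. x j * x k) + fps_const e * x i ^ 3) =
      fps_cutoff n ((\<Sum>(j, k)\<in>#T i. y j * y k) + fps_const e * y i ^ 3)" (is "fps_cutoff n ?f = fps_cutoff n ?g")
    unfolding power3_eq_cube by (intro fps_cutoff_add_cong fps_cutoff_mult_cong sums assms refl)
  then have "?f $ m = ?g $ m" if "m < n" for m
    using that unfolding fps_eq_iff fps_cutoff_nth by metis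
  then show ?thesis
    unfolding system_map_def by (intro fps_ext) (auto simp: less_Suc_eq_0_disj)
qed

text \<open>The iterates from 0 converge coefficientwise, as in Banach's fixed-point
  theorem.\<close>

lemma system_map_fixpoint:
  fixes a :: "'i \<Rightarrow> 'b::comm_ring_1"
  shows "\<exists>y. system_map e a T y = y"
proof -
  define F where "F = system_map e a T"
  define z where "z n = (F ^^ n) (\<lambda>_. 0)" for n
  have zS: "z (Suc n) = F (z n)" for n by (simp add: z_def)
  have step: "fps_cutoff n (z n i) = fps_cutoff n (z (Suc n) i)" for n i
  proof (induction n arbitrary: i)
    case (Suc n)
    then show ?case unfolding zS[of n] zS[of "Suc n"] F_def by (intro system_map_cutoff)
  qed simp
  have stable: "z (n + k) i $ m = z n i $ m" if "m < n" for m n k i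
  proof (induction k)
    case (Suc k)
    have "m < n + k" using that by simp
    with step[of "n + k" i] have "z (Suc (n + k)) i $ m = z (n + k) i $ m"
      unfolding fps_eq_iff fps_cutoff_nth by metis
    then show ?case using Suc by simp
  qed simp
  \<comment> \<open>Coefficient \<open>m\<close> no longer changes from iterate \<open>Suc m\<close>
    on.\<close>
  define y where "y i = Abs_fps (\<lambda>m. z (Suc m) i $ m)" for i
  have y: "fps_cutoff n (y i) = fps_cutoff n (z n i)" for n i
  proof (rule fps_ext)
    fix m
    show "fps_cutoff n (y i) $ m = fps_cutoff n (z n i) $ m"
      using stable[of m "Suc m" "n - Suc m" i] by (auto simp: y_def)
  qed
  have "F y i $ n = y i $ n" for i n
  proof -
    have "fps_cutoff (Suc n) (F y i) = fps_cutoff (Suc n) (F (z n) i)"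
      unfolding F_def by (intro system_map_cutoff y)
    then have "fps_cutoff (Suc n) (F y i) = fps_cutoff (Suc n) (y i)"
      by (simp only: y flip: zS)
    then show ?thesis unfolding fps_eq_iff fps_cutoff_nth by (metis lessI)
  qed
  then have "F y = y" by (auto simp: fps_eq_iff)
  then show ?thesis unfolding F_def by blast
qed

lemma algebraic_fpsI:
  assumes "\<exists>m\<le>N. l m \<noteq> 0" "(\<Sum>m\<le>N. fps_of_poly (l m) * F ^ m) = 0"
  shows "algebraic_fps F"
proof -
  define P where "P = (\<Sum>m\<le>N. monom (l m) m)"
  have cP: "coeff P m = (if m \<le> N then l m else 0)" for m
    by (simp add: P_def coeff_sum)
  then have "P \<noteq> 0" using assms(1) by (metis coeff_0)
  have deg: "degree P \<le> N" by (rule degree_le) (simp add: cP)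
  have "poly (map_poly fps_of_poly P) F = (\<Sum>m\<le>N. fps_of_poly (l m) * F ^ m)"
  proof -
    have "degree (map_poly fps_of_poly P) \<le> N"
      using deg by (subst degree_map_poly) (auto simp: fps_of_poly_eq_iff[of _ 0, simplified])
    then have "poly (map_poly fps_of_poly P) F = (\<Sum>m\<le>N. coeff (map_poly fps_of_poly P) m * F ^ m)"
      unfolding poly_altdef by (intro sum.mono_neutral_left) (auto intro: coeff_eq_0)
    then show ?thesis by (simp add: coeff_map_poly cP)
  qed
  then show ?thesis unfolding algebraic_fps_def using assms(2) \<open>P \<noteq> 0\<close> by metis
qed

theorem algebraic_system:
  fixes a :: "'i \<Rightarrow> 'b::field"
  assumes "finite I" "\<And>i. i \<in> I \<Longrightarrow> set_mset (T i) \<subseteq> I \<times> I"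
  shows "\<exists>y. (\<forall>i. y i = fps_const (a i) + fps_X * (\<Sum>(j, k)\<in>#T i. y j * y k)) \<and>
             (\<forall>i\<in>I. algebraic_fps (y i))"
proof -
  \<comment> \<open>The parameter \<open>e\<close> is adjoined as the variable
    \<open>[:0, 1:]\<close> of \<open>'b poly\<close>. Since \<open>specialize\<close> sends it to
    0, the cubic terms vanish and the original system remains.\<close>
  obtain Y where Y: "system_map [:0, 1:] (\<lambda>i. [:a i:]) T Y = Y"
    using system_map_fixpoint by metis
  have eq: "Y i = fps_const [:a i:] + fps_X * ((\<Sum>(j, k)\<in>#T i. Y j * Y k) + fps_const [:0, 1:] * Y i ^ 3)" for i
    using fun_cong[OF Y, of i] unfolding system_map_def by (rule sym)
  define y where "y i = specialize (Y i)" for i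
  have "y i = fps_const (a i) + fps_X * (\<Sum>(j, k)\<in>#T i. y j * y k)" for i
  proof -
    have "(\<lambda>(j, k). specialize (Y j * Y k)) = (\<lambda>(j, k). y j * y k)"
      by (auto simp: y_def specialize_mult)
    then show ?thesis
      unfolding y_def by (subst eq) (simp add: specialize_add specialize_mult specialize_sum_mset
        case_prod_unfold)
  qed
  moreover have "algebraic_fps (y i)" if i: "i \<in> I" for i
  proof -
    obtain N l where l: "\<exists>m\<le>N. l m \<noteq> 0" "(\<Sum>m\<le>N. fps_of_poly (l m) * Y i ^ m) = 0"
      using perturbed_system_algebraic[OF assms(1) _ assms(2) eq i] by (auto simp: pCons_eq_0_iff)
    from specialize_algebraic[OF l] show ?thesis unfolding y_def by (blast intro: algebraic_fpsI)
  qed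
  ultimately show ?thesis by blast
qed

section \<open>Deterministic one-counter systems\<close>

primrec path_weight :: "('s \<Rightarrow> 'a \<Rightarrow> 's) \<Rightarrow> 'a set \<Rightarrow> ('s \<Rightarrow> 'b::comm_ring_1) \<Rightarrow> nat \<Rightarrow> 's \<Rightarrow> 'b" where
  "path_weight \<delta> S f 0 x = f x"
| "path_weight \<delta> S f (Suc n) x = (\<Sum>s\<in>S. path_weight \<delta> S f n (\<delta> x s))"

text \<open>Coefficient \<open>Suc n\<close> on the left depends only on coefficients
  \<open>n\<close> on the right, so this linear system has one solution even for infinite
  \<open>X\<close>. It identifies series built from finitely many unknowns with the walk
  counts.\<close>

lemma path_weight_unique:
  assumes "\<And>x s. x \<in> X \<Longrightarrow> s \<in> S \<Longrightarrow> \<delta> x s \<in> X"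
    and "\<And>x. x \<in> X \<Longrightarrow> U x = fps_const (f x) + fps_X * (\<Sum>s\<in>S. U (\<delta> x s))"
    and "x \<in> X"
  shows "U x = Abs_fps (\<lambda>n. path_weight \<delta> S f n x)"
proof (rule fps_ext)
  fix n
  have "U x $ n = path_weight \<delta> S f n x" using assms(3)
  proof (induction n arbitrary: x)
    case 0
    then show ?case by (subst assms(2)) simp_all
  next
    case (Suc n)
    have "U x $ Suc n = (\<Sum>s\<in>S. U (\<delta> x s) $ n)"
      by (subst assms(2)[OF Suc.prems]) (simp add: fps_sum_nth)
    then show ?case using Suc assms(1) by simp
  qed
  then show "U x $ n = Abs_fps (\<lambda>n. path_weight \<delta> S f n x) $ n" by simp
qed

lemma set_mset_sum: "finite A \<Longrightarrow> set_mset (\<Sum>x\<in>A. f x) = (\<Union>x\<in>A. set_mset (f x))"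
  by (induction A rule: finite_induct) auto

lemma sum_mset_image_mset_sum:
  "(\<Sum>z\<in>#(\<Sum>x\<in>A. f x). g z) = (\<Sum>x\<in>A. \<Sum>z\<in>#f x. g z)"
  by (induction A rule: infinite_finite_induct) auto

datatype ('p, 's) unknown = One | Ret 'p 'p | Stay 'p | Start 's

text \<open>
  A deterministic system whose states outside the finite set \<open>Low\<close> carry a counter
  \<open>level\<close> and a finite control \<open>ctrl\<close>; on these the control determines the transition,
  and \<open>low\<close> decodes the control when the counter drops below 0.
\<close>

locale one_counter =
  fixes \<delta> :: "'s \<Rightarrow> 'a \<Rightarrow> 's" and S :: "'a set" and X Low :: "'s set" and P :: "'p set"
    and f :: "'s \<Rightarrow> 'b::field" and level :: "'s \<Rightarrow> nat" and ctrl :: "'s \<Rightarrow> 'p"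
    and nxt :: "'p \<Rightarrow> 'a \<Rightarrow> 'p" and jump :: "'p \<Rightarrow> 'a \<Rightarrow> int"
    and g :: "'p \<Rightarrow> 'b" and low :: "'p \<Rightarrow> 's"
  assumes finite: "finite S" "finite Low" "finite P"
    and Low_X: "Low \<subseteq> X"
    and ctrl_P: "\<And>x. x \<in> X - Low \<Longrightarrow> ctrl x \<in> P"
    and nxt_P: "\<And>p s. p \<in> P \<Longrightarrow> s \<in> S \<Longrightarrow> nxt p s \<in> P"
    and jump: "\<And>p s. p \<in> P \<Longrightarrow> s \<in> S \<Longrightarrow> jump p s \<in> {-1, 0, 1}"
    and low_Low: "\<And>p. p \<in> P \<Longrightarrow> low p \<in> Low"
    and g_ctrl: "\<And>x. x \<in> X - Low \<Longrightarrow> f x = g (ctrl x)"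
    and high_step: "\<And>x s. x \<in> X - Low \<Longrightarrow> s \<in> S \<Longrightarrow>
      \<delta> x s \<in> X - Low \<and> int (level (\<delta> x s)) = int (level x) + jump (ctrl x) s \<and>
        ctrl (\<delta> x s) = nxt (ctrl x) s \<or>
      \<delta> x s = low (nxt (ctrl x) s) \<and> level x = 0 \<and> jump (ctrl x) s = -1"
    and low_step: "\<And>x s. x \<in> Low \<Longrightarrow> s \<in> S \<Longrightarrow>
      \<delta> x s \<in> Low \<or> \<delta> x s \<in> X - Low \<and> level (\<delta> x s) = 0"
begin

text \<open>
  \<open>Ret p r\<close> counts the walks from control \<open>p\<close> that drop one level for the first time in their
  last step, in control \<open>r\<close>; \<open>Stay p\<close> the accepted ones that never drop; \<open>Start x\<close> all
  accepted walks from \<open>x\<close>. \<open>One\<close> makes all terms of the system homogeneous quadratic.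
\<close>

definition const_part :: "('p, 's) unknown \<Rightarrow> 'b" where
  "const_part i = (case i of One \<Rightarrow> 1 | Ret p r \<Rightarrow> 0 | Stay p \<Rightarrow> g p | Start x \<Rightarrow> f x)"

definition quad_part :: "('p, 's) unknown \<Rightarrow> (('p, 's) unknown \<times> ('p, 's) unknown) multiset" where
  "quad_part i = (case i of
     One \<Rightarrow> {#}
   | Ret p r \<Rightarrow> (\<Sum>s\<in>S.
       if jump p s = -1 then (if nxt p s = r then {#(One, One)#} else {#})
       else if jump p s = 0 then {#(One, Ret (nxt p s) r)#}
       else (\<Sum>q\<in>P. {#(Ret (nxt p s) q, Ret q r)#}))
   | Stay p \<Rightarrow> (\<Sum>s\<in>S.
       if jump p s = -1 then {#}
       else if jump p s = 0 then {#(One, Stay (nxt p s))#}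
       else {#(One, Stay (nxt p s))#} + (\<Sum>q\<in>P. {#(Ret (nxt p s) q, Stay q)#}))
   | Start x \<Rightarrow> (\<Sum>s\<in>S.
       if \<delta> x s \<in> Low then {#(One, Start (\<delta> x s))#}
       else {#(One, Stay (ctrl (\<delta> x s)))#} +
         (\<Sum>q\<in>P. {#(Ret (ctrl (\<delta> x s)) q, Start (low q))#})))"

definition unknowns :: "('p, 's) unknown set" where
  "unknowns = {One} \<union> (\<lambda>(p, r). Ret p r) ` (P \<times> P) \<union> Stay ` P \<union> Start ` Low"

lemma unknowns_simps [simp]:
  "One \<in> unknowns"
  "Ret p r \<in> unknowns \<longleftrightarrow> p \<in> P \<and> r \<in> P"
  "Stay p \<in> unknowns \<longleftrightarrow> p \<in> P"
  "Start x \<in> unknowns \<longleftrightarrow> x \<in> Low"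
  by (auto simp: unknowns_def)

lemma finite_unknowns: "finite unknowns"
  unfolding unknowns_def using finite by blast

lemma quad_part_closed:
  assumes "i \<in> unknowns"
  shows "set_mset (quad_part i) \<subseteq> unknowns \<times> unknowns"
proof -
  have ctrl: "ctrl (\<delta> x s) \<in> P" if "x \<in> Low" "s \<in> S" "\<delta> x s \<notin> Low" for x s
    using low_step[OF that(1,2)] that(3) ctrl_P by auto
  show ?thesis
    using assms
    by (cases i) (auto simp: quad_part_def set_mset_sum finite nxt_P low_Low ctrl split: if_splits)
qed

text \<open>Meant as the series of accepted walks from control \<open>p\<close>, with the index one
  above the counter: \<open>Suc k\<close> stands for counter \<open>k\<close>, and 0 for a counter
  that has just dropped below 0. A walk either never drops or is split at its first drop.\<close>

primrec value_below :: "(('p, 's) unknown \<Rightarrow> 'b fps) \<Rightarrow> nat \<Rightarrow> 'p \<Rightarrow> 'b fps" where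
  "value_below y 0 p = y (Start (low p))"
| "value_below y (Suc k) p = y (Stay p) + (\<Sum>q\<in>P. y (Ret p q) * value_below y k q)"

context
  fixes y :: "('p, 's) unknown \<Rightarrow> 'b fps"
  assumes y: "\<And>i. y i = fps_const (const_part i) + fps_X * (\<Sum>(j, k)\<in>#quad_part i. y j * y k)"
begin

lemma y_One: "y One = 1"
  by (subst y) (simp add: const_part_def quad_part_def)

lemma y_Ret: "y (Ret p r) = fps_X * (\<Sum>s\<in>S.
    if jump p s = -1 then (if nxt p s = r then 1 else 0)
    else if jump p s = 0 then y (Ret (nxt p s) r)
    else (\<Sum>q\<in>P. y (Ret (nxt p s) q) * y (Ret q r)))"
proof -
  have "(\<Sum>(j, k)\<in>#quad_part (Ret p r). y j * y k) = (\<Sum>s\<in>S.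
    if jump p s = -1 then (if nxt p s = r then 1 else 0)
    else if jump p s = 0 then y (Ret (nxt p s) r)
    else (\<Sum>q\<in>P. y (Ret (nxt p s) q) * y (Ret q r)))"
    unfolding quad_part_def unknown.case sum_mset_image_mset_sum
    by (intro sum.cong) (auto simp: sum_mset_image_mset_sum y_One)
  then show ?thesis by (subst y) (simp add: const_part_def)
qed

lemma y_Stay: "y (Stay p) = fps_const (g p) + fps_X * (\<Sum>s\<in>S.
    if jump p s = -1 then 0
    else if jump p s = 0 then y (Stay (nxt p s))
    else y (Stay (nxt p s)) + (\<Sum>q\<in>P. y (Ret (nxt p s) q) * y (Stay q)))"
proof -
  have "(\<Sum>(j, k)\<in>#quad_part (Stay p). y j * y k) = (\<Sum>s\<in>S.
    if jump p s = -1 then 0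
    else if jump p s = 0 then y (Stay (nxt p s))
    else y (Stay (nxt p s)) + (\<Sum>q\<in>P. y (Ret (nxt p s) q) * y (Stay q)))"
    unfolding quad_part_def unknown.case sum_mset_image_mset_sum
    by (intro sum.cong) (auto simp: sum_mset_image_mset_sum y_One)
  then show ?thesis by (subst y) (simp add: const_part_def)
qed

lemma y_Start: "y (Start x) = fps_const (f x) + fps_X * (\<Sum>s\<in>S.
    if \<delta> x s \<in> Low then y (Start (\<delta> x s)) else value_below y 1 (ctrl (\<delta> x s)))"
proof -
  have "(\<Sum>(j, k)\<in>#quad_part (Start x). y j * y k) = (\<Sum>s\<in>S.
    if \<delta> x s \<in> Low then y (Start (\<delta> x s)) else value_below y 1 (ctrl (\<delta> x s)))"
    unfolding quad_part_def unknown.case sum_mset_image_mset_sum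
    by (intro sum.cong) (auto simp: sum_mset_image_mset_sum y_One)
  then show ?thesis by (subst y) (simp add: const_part_def)
qed

text \<open>The first-passage equations for \<open>Ret\<close> and \<open>Stay\<close> recombine
  into a linear one-step equation at each counter value, the form that
  \<open>path_weight_unique\<close> needs.\<close>

lemma value_below_Suc:
  assumes "p \<in> P"
  shows "value_below y (Suc k) p = fps_const (g p) + fps_X * (\<Sum>s\<in>S.
    if jump p s = -1 then value_below y k (nxt p s)
    else if jump p s = 0 then value_below y (Suc k) (nxt p s)
    else value_below y (Suc (Suc k)) (nxt p s))"
proof -
  let ?B = "value_below y"
  have drop: "(\<Sum>q\<in>P. y (Ret p q) * ?B k q) = fps_X * (\<Sum>s\<in>S. \<Sum>q\<in>P.
      (if jump p s = -1 then (if nxt p s = q then 1 else 0)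
       else if jump p s = 0 then y (Ret (nxt p s) q)
       else (\<Sum>r\<in>P. y (Ret (nxt p s) r) * y (Ret r q))) * ?B k q)"
    by (subst y_Ret, subst sum.swap) (simp add: sum_distrib_left sum_distrib_right mult.assoc)
  have "?B (Suc k) p = fps_const (g p) + fps_X * (\<Sum>s\<in>S.
    (if jump p s = -1 then 0
      else if jump p s = 0 then y (Stay (nxt p s))
      else y (Stay (nxt p s)) + (\<Sum>q\<in>P. y (Ret (nxt p s) q) * y (Stay q))) +
    (\<Sum>q\<in>P.
      (if jump p s = -1 then (if nxt p s = q then 1 else 0)
       else if jump p s = 0 then y (Ret (nxt p s) q)
       else (\<Sum>r\<in>P. y (Ret (nxt p s) r) * y (Ret r q))) * ?B k q))" (is "_ = _ + _ * (\<Sum>s\<in>S. ?t s)")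
    unfolding value_below.simps(2) drop sum.distrib distrib_left
    by (subst y_Stay[of p]) (simp only: add.assoc)
  also have "(\<Sum>s\<in>S. ?t s) = (\<Sum>s\<in>S.
    if jump p s = -1 then ?B k (nxt p s)
    else if jump p s = 0 then ?B (Suc k) (nxt p s)
    else ?B (Suc (Suc k)) (nxt p s))"
  proof (intro sum.cong refl)
    fix s assume s: "s \<in> S"
    consider "jump p s = -1" | "jump p s = 0" | "jump p s \<noteq> -1" "jump p s \<noteq> 0" by blast
    then show "?t s = (if jump p s = -1 then ?B k (nxt p s)
      else if jump p s = 0 then ?B (Suc k) (nxt p s) else ?B (Suc (Suc k)) (nxt p s))"
    proof cases
      case 1
      have "(\<Sum>q\<in>P. (if nxt p s = q then 1 else 0) * ?B k q) = ?B k (nxt p s)"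
        using finite(3) nxt_P[OF assms s] by (simp add: if_distrib[of "\<lambda>x. x * _"] cong: if_cong)
      with 1 show ?thesis by simp
    next
      case 3
      \<comment> \<open>After a rise, two drops lead below the starting level, first in control
        \<open>r\<close> and then in \<open>q\<close>; exchanging the sums groups them by
        \<open>r\<close>.\<close>
      have "(\<Sum>q\<in>P. (\<Sum>r\<in>P. y (Ret (nxt p s) r) * y (Ret r q)) * ?B k q) =
          (\<Sum>r\<in>P. y (Ret (nxt p s) r) * (\<Sum>q\<in>P. y (Ret r q) * ?B k q))"
        unfolding sum_distrib_left sum_distrib_right by (subst sum.swap) (simp only: mult.assoc)
      with 3 show ?thesis by (simp add: distrib_left sum.distrib add.assoc)
    qed simp
  qed
  finally show ?thesis .
qed

end

theorem algebraic_path_weight: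
  assumes "x \<in> Low"
  shows "algebraic_fps (Abs_fps (\<lambda>n. path_weight \<delta> S f n x))"
proof -
  obtain y where
    sys: "\<forall>i. y i = fps_const (const_part i) + fps_X * (\<Sum>(j, k)\<in>#quad_part i. y j * y k)"
    and alg: "\<forall>i\<in>unknowns. algebraic_fps (y i)"
    using algebraic_system[where T = quad_part and a = const_part, OF finite_unknowns quad_part_closed] by blast
  note y = sys[THEN spec]
  \<comment> \<open>The candidate for every state, built from the finitely many unknowns, with the
    index shift of \<open>value_below\<close>.\<close>
  define U where "U x = (if x \<in> Low then y (Start x) else value_below y (Suc (level x)) (ctrl x))" for x
  have "U x = Abs_fps (\<lambda>n. path_weight \<delta> S f n x)"
  proof (rule path_weight_unique)
    show "x \<in> X" using assms Low_X by blast
    show "\<delta> x s \<in> X" if "x \<in> X" "s \<in> S" for x s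
      using high_step[of x s] low_step[of x s] low_Low[OF nxt_P[OF ctrl_P[of x]], of s] Low_X that
      by (cases "x \<in> Low") auto
    show "U x = fps_const (f x) + fps_X * (\<Sum>s\<in>S. U (\<delta> x s))" if x: "x \<in> X" for x
    proof (cases "x \<in> Low")
      case True
      have "U x = y (Start x)" by (simp add: U_def True)
      also note y_Start[OF y, of x]
      also have "(\<Sum>s\<in>S. if \<delta> x s \<in> Low then y (Start (\<delta> x s)) else value_below y 1 (ctrl (\<delta> x s))) =
          (\<Sum>s\<in>S. U (\<delta> x s))"
      proof (intro sum.cong refl)
        fix s assume "s \<in> S"
        \<comment> \<open>A state outside \<open>Low\<close> entered from \<open>Low\<close> has
          counter 0, hence index 1.\<close>
        from low_step[OF True this]
        show "(if \<delta> x s \<in> Low then y (Start (\<delta> x s)) else value_below y 1 (ctrl (\<delta> x s))) = U (\<delta> x s)"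
          by (auto simp: U_def)
      qed
      finally show ?thesis .
    next
      case False
      then have p: "ctrl x \<in> P" using ctrl_P x by blast
      have "U x = value_below y (Suc (level x)) (ctrl x)" using False by (simp add: U_def)
      also note value_below_Suc[OF y p, of "level x"]
      also have "(\<Sum>s\<in>S.
          if jump (ctrl x) s = -1 then value_below y (level x) (nxt (ctrl x) s)
          else if jump (ctrl x) s = 0 then value_below y (Suc (level x)) (nxt (ctrl x) s)
          else value_below y (Suc (Suc (level x))) (nxt (ctrl x) s)) = (\<Sum>s\<in>S. U (\<delta> x s))"
      proof (intro sum.cong refl)
        fix s assume s: "s \<in> S"
        have j: "jump (ctrl x) s \<in> {-1, 0, 1}" using jump p s by blast
        consider "\<delta> x s \<notin> Low" "int (level (\<delta> x s)) = int (level x) + jump (ctrl x) s"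
            "ctrl (\<delta> x s) = nxt (ctrl x) s"
          | "\<delta> x s = low (nxt (ctrl x) s)" "level x = 0" "jump (ctrl x) s = -1"
          using high_step[of x s] x False s by auto
        then show "(if jump (ctrl x) s = -1 then value_below y (level x) (nxt (ctrl x) s)
          else if jump (ctrl x) s = 0 then value_below y (Suc (level x)) (nxt (ctrl x) s)
          else value_below y (Suc (Suc (level x))) (nxt (ctrl x) s)) = U (\<delta> x s)"
        proof cases
          case 1
          have U: "U (\<delta> x s) = value_below y (Suc (level (\<delta> x s))) (nxt (ctrl x) s)"
            using 1 by (simp add: U_def)
          from j consider "jump (ctrl x) s = -1" | "jump (ctrl x) s = 0" | "jump (ctrl x) s = 1" by auto
          then show ?thesis
          proof cases
            case 1
            with \<open>int (level (\<delta> x s)) = _\<close> have "level x = Suc (level (\<delta> x s))" by linarith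
            with 1 show ?thesis unfolding U by (simp del: value_below.simps)
          next
            case 2
            with \<open>int (level (\<delta> x s)) = _\<close> have "level (\<delta> x s) = level x" by linarith
            with 2 show ?thesis unfolding U by (simp del: value_below.simps)
          next
            case 3
            with \<open>int (level (\<delta> x s)) = _\<close> have "level (\<delta> x s) = Suc (level x)" by linarith
            with 3 show ?thesis unfolding U by (simp del: value_below.simps)
          qed
        next
          \<comment> \<open>Dropping below counter 0 leads to index 0 of \<open>value_below\<close>,
            the unknown of the decoded low state.\<close>
          case 2
          then show ?thesis using low_Low nxt_P p s by (simp add: U_def)
        qed
      qed
      also have "g (ctrl x) = f x" using g_ctrl[of x] x False by simp
      finally show ?thesis .
    qed
  qed
  moreover have "U x = y (Start x)" using assms by (simp add: U_def)
  moreover have "algebraic_fps (y (Start x))" using alg assms by simp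
  ultimately show ?thesis by simp
qed

end

section \<open>Regular shape of the types\<close>

text \<open>
  Away from its ends \<open>R\<close> is periodic with bounded gaps. The ends are bounds \<open>lo\<close>, \<open>hi\<close> instead
  of the extreme elements, since pruning may remove the latter.
\<close>

definition regular_shape :: "int \<Rightarrow> int \<Rightarrow> int set \<Rightarrow> bool" where
  "regular_shape L P R \<longleftrightarrow> (\<exists>lo hi. (\<forall>x\<in>R. lo \<le> x \<and> x \<le> hi) \<and>
     (\<forall>x. lo + L \<le> x \<longrightarrow> x + P + L \<le> hi \<longrightarrow> (x \<in> R \<longleftrightarrow> x + P \<in> R)) \<and>
     (\<forall>z. lo + L \<le> z \<longrightarrow> z + P + L \<le> hi \<longrightarrow> (\<exists>y\<in>R. z \<le> y \<and> y \<le> z + P)))"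

lemma regular_shape_mono:
  assumes "regular_shape L P R" "L \<le> L'" "P dvd P'" "0 < P" "0 < P'"
  shows "regular_shape L' P' R"
proof -
  from assms(1) obtain lo hi where bounds: "\<forall>x\<in>R. lo \<le> x \<and> x \<le> hi"
    and per: "\<And>x. lo + L \<le> x \<Longrightarrow> x + P + L \<le> hi \<Longrightarrow> x \<in> R \<longleftrightarrow> x + P \<in> R"
    and gap: "\<And>z. lo + L \<le> z \<Longrightarrow> z + P + L \<le> hi \<Longrightarrow> \<exists>y\<in>R. z \<le> y \<and> y \<le> z + P"
    unfolding regular_shape_def by blast
  obtain q where q: "P' = P * int q"
    using assms(3-5) by (metis dvdE pos_int_cases zero_less_mult_pos)
  have per': "x \<in> R \<longleftrightarrow> x + P * int k \<in> R" if "lo + L \<le> x" "x + P * int k + L \<le> hi" for x k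
    using that
  proof (induction k)
    case (Suc k)
    have "0 \<le> P * int k" using assms(4) by simp
    with Suc per[of "x + P * int k"] show ?case using assms(4) by (simp add: algebra_simps)
  qed simp
  have "P \<le> P'" using assms(3,5) by (simp add: zdvd_imp_le)
  show ?thesis unfolding regular_shape_def
  proof (rule exI[of _ lo], rule exI[of _ hi], intro conjI allI impI)
    show "\<forall>x\<in>R. lo \<le> x \<and> x \<le> hi" by (rule bounds)
  next
    fix x assume "lo + L' \<le> x" "x + P' + L' \<le> hi"
    then show "x \<in> R \<longleftrightarrow> x + P' \<in> R" unfolding q using assms(2) q by (intro per') auto
  next
    fix z assume "lo + L' \<le> z" "z + P' + L' \<le> hi"
    then obtain y where "y \<in> R" "z \<le> y" "y \<le> z + P"
      using gap[of z] assms(2) \<open>P \<le> P'\<close> by auto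
    then show "\<exists>y\<in>R. z \<le> y \<and> y \<le> z + P'" using \<open>P \<le> P'\<close> by force
  qed
qed

lemma sumset_fold_zero_step: "sumset_fold j {0, n} = {int i * n |i. i \<le> j}"
proof (induction j)
  case (Suc j)
  have "{int i * n |i. i \<le> Suc j} = {int i * n |i. i \<le> j} \<union> {n + int i * n |i. i \<le> j}" (is "?A = ?B \<union> ?C")
  proof
    show "?A \<subseteq> ?B \<union> ?C"
    proof
      fix x assume "x \<in> ?A"
      then obtain i where i: "x = int i * n" "i \<le> Suc j" by blast
      show "x \<in> ?B \<union> ?C"
      proof (cases i)
        case 0 then show ?thesis using i by auto
      next
        case (Suc k) then show ?thesis using i by (auto simp: algebra_simps)
      qed
    qed
    show "?B \<union> ?C \<subseteq> ?A"
    proof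
      fix x assume "x \<in> ?B \<union> ?C"
      then obtain i where "i \<le> j" "x = int i * n \<or> x = n + int i * n" by blast
      then have "x = int i * n \<and> i \<le> Suc j \<or> x = int (Suc i) * n \<and> Suc i \<le> Suc j"
        by (auto simp: algebra_simps)
      then show "x \<in> ?A" by blast
    qed
  qed
  then show ?case using Suc by (auto simp: set_plus_def)
qed auto

lemma mem_translate_iff: "x \<in> Y + {m} \<longleftrightarrow> x - m \<in> (Y :: int set)"
  by (auto simp: set_plus_def) (metis diff_add_cancel)

text \<open>\<open>j\<close> copies of \<open>{0, n}\<close> sum to the progression
  \<open>0, n, ..., j n\<close>. Adding \<open>b\<close> gives, between the ends, a union of residue
  classes modulo \<open>n\<close>, and pruning only removes points at a bounded distance from the
  ends. None of this depends on \<open>j\<close> or the shift \<open>m\<close>.\<close>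

lemma reach_type_regular_shape:
  assumes "finite a" "finite b" "finite c"
  shows "\<exists>L P. 0 \<le> L \<and> 0 < P \<and>
           (\<forall>R\<in>reach_type n k a b c. R \<noteq> {} \<longrightarrow> regular_shape L P R)"
proof -
  obtain \<beta> where \<beta>: "\<And>x. x \<in> a \<union> b \<union> c \<Longrightarrow> \<bar>x\<bar> \<le> \<beta>" "0 \<le> \<beta>"
  proof
    let ?A = "insert 0 (a \<union> b \<union> c)"
    show "\<bar>x\<bar> \<le> Max (abs ` ?A)" if "x \<in> a \<union> b \<union> c" for x
      using that assms by (intro Max_ge) auto
    show "0 \<le> Max (abs ` ?A)" using assms by (intro Max_ge) auto
  qed
  \<comment> \<open>Where there is a middle part, pruning reaches at most \<open>3 * \<beta>\<close>
    inward from the bounds \<open>m - \<beta>\<close> and \<open>m + ?N + \<beta>\<close> used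
    below; \<open>L\<close> exceeds this.\<close>
  define L where "L = 4 * \<beta> + 1"
  \<comment> \<open>For \<open>n = 0\<close> there is no middle part, and 1 is just a positive
    default.\<close>
  define P where "P = (if n = 0 then 1 else int n)"
  have "regular_shape L P R" if R: "R \<in> reach_type n k a b c" "R \<noteq> {}" for R
  proof -
    obtain m j where R_eq: "R = top_prune (bottom_prune (sumset_fold j {0, int n} + b) a) c + {m}"
      using R(1) unfolding reach_type_def by blast
    define B where "B = sumset_fold j {0, int n} + b"
    define Y where "Y = bottom_prune B a"
    define Z where "Z = top_prune Y c"
    have RZ: "x \<in> R \<longleftrightarrow> x - m \<in> Z" for x
      unfolding R_eq Z_def Y_def B_def by (rule mem_translate_iff)
    have B_iff: "y \<in> B \<longleftrightarrow> (\<exists>i\<le>j. \<exists>x\<in>b. y = int i * int n + x)" for y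
      unfolding B_def sumset_fold_zero_step by (auto simp: set_plus_def)
    have finB: "finite B"
    proof -
      have "B = (\<lambda>(i, x). int i * int n + x) ` ({..j} \<times> b)" using B_iff by auto
      then show ?thesis using assms by simp
    qed
    have ZY: "Z \<subseteq> Y" and YB: "Y \<subseteq> B"
      unfolding Z_def Y_def top_prune_def bottom_prune_def by auto
    have "Z \<noteq> {}" using R(2) RZ by blast
    then have ne: "Y \<noteq> {}" "B \<noteq> {}" "b \<noteq> {}" using ZY YB B_iff by blast+
    then obtain b0 where b0: "b0 \<in> b" by blast
    let ?N = "int j * int n"
    have N: "int i * int n \<le> ?N" if "i \<le> j" for i using that by (intro mult_right_mono) auto
    have B_bounds: "- \<beta> \<le> y" "y \<le> ?N + \<beta>" if yB: "y \<in> B" for y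
    proof -
      from yB obtain i x where "i \<le> j" "x \<in> b" "y = int i * int n + x" using B_iff by blast
      with \<beta>(1)[of x] N[of i] show "- \<beta> \<le> y" "y \<le> ?N + \<beta>" by (auto simp: add_increasing)
    qed
    have minB: "Min B \<le> \<beta>"
    proof -
      have "b0 \<in> B" using b0 B_iff[of b0] by force
      then have "Min B \<le> b0" using finB by simp
      then show ?thesis using \<beta>(1)[of b0] b0 by auto
    qed
    have YB_iff: "y \<in> Y \<longleftrightarrow> y \<in> B" if "2 * \<beta> < y" for y
    proof -
      have "y \<notin> {Min B} + a"
      proof
        assume "y \<in> {Min B} + a"
        then obtain t where "t \<in> a" "y = Min B + t" by (auto simp: set_plus_def)
        with \<beta>(1)[of t] minB that show False by auto
      qed
      then show ?thesis using ne by (auto simp: Y_def bottom_prune_def)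
    qed
    have mid: "y \<in> Z \<longleftrightarrow> (\<exists>x\<in>b. int n dvd y - x)"
      if y: "2 * \<beta> < y" "y < ?N - 2 * \<beta>" "0 < n" for y
    proof -
      have "?N + b0 \<in> B" using b0 B_iff by blast
      then have "?N + b0 \<in> Y" using YB_iff[of "?N + b0"] y \<beta>(1)[of b0] b0 \<beta>(2) by auto
      moreover have "finite Y" using YB finB finite_subset by blast
      ultimately have "?N + b0 \<le> Max Y" by simp
      then have maxY: "?N - \<beta> \<le> Max Y" using \<beta>(1)[of b0] b0 by auto
      have "y \<notin> {Max Y - t |t. t \<in> c}"
      proof
        assume "y \<in> {Max Y - t |t. t \<in> c}"
        then obtain t where "t \<in> c" "y = Max Y - t" by blast
        with \<beta>(1)[of t] maxY y show False by auto
      qed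
      then have "y \<in> Z \<longleftrightarrow> y \<in> B" using YB_iff[OF y(1)] ne by (auto simp: Z_def top_prune_def)
      also have "\<dots> \<longleftrightarrow> (\<exists>x\<in>b. int n dvd y - x)"
      proof
        assume "y \<in> B"
        then show "\<exists>x\<in>b. int n dvd y - x" using B_iff[of y] by force
      next
        assume "\<exists>x\<in>b. int n dvd y - x"
        then obtain x q where x: "x \<in> b" "y - x = int n * q"
          unfolding dvd_def by blast
        have "0 \<le> y - x" "y - x \<le> ?N" using \<beta>(1)[of x] x(1) y \<beta>(2) by auto
        then have "int n * 0 \<le> int n * q" "int n * q \<le> int n * int j"
          unfolding x(2) by (simp_all add: mult.commute)
        then have "0 \<le> q" "q \<le> int j" using y(3) by (auto simp: zero_le_mult_iff)
        then have "y = int (nat q) * int n + x" "nat q \<le> j" using x by (auto simp: algebra_simps)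
        then show "y \<in> B" using B_iff x(1) by blast
      qed
      finally show ?thesis .
    qed
    \<comment> \<open>For \<open>n = 0\<close> the two bounds are closer than \<open>2 * L\<close>,
      so no such \<open>z\<close> exists.\<close>
    have "0 < n" if "m - \<beta> + L \<le> z" "z + P + L \<le> m + ?N + \<beta>" for z
      using that \<beta>(2) by (cases n) (auto simp: L_def P_def)
    note n_pos = this
    show ?thesis unfolding regular_shape_def
    proof (rule exI[of _ "m - \<beta>"], rule exI[of _ "m + ?N + \<beta>"], intro conjI allI impI)
      show "\<forall>x\<in>R. m - \<beta> \<le> x \<and> x \<le> m + ?N + \<beta>"
      proof
        fix x assume "x \<in> R"
        then have "x - m \<in> B" using RZ ZY YB by blast
        from B_bounds[OF this] show "m - \<beta> \<le> x \<and> x \<le> m + ?N + \<beta>" by auto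
      qed
    next
      fix x assume x: "m - \<beta> + L \<le> x" "x + P + L \<le> m + ?N + \<beta>"
      then have n: "0 < n" by (rule n_pos)
      have P: "P = int n" using n by (simp add: P_def)
      have "int n dvd x - m - t \<longleftrightarrow> int n dvd x + P - m - t" for t
      proof -
        have "x + P - m - t = (x - m - t) + int n" using P by simp
        then show ?thesis by (simp only: dvd_add_triv_right_iff)
      qed
      then show "x \<in> R \<longleftrightarrow> x + P \<in> R"
        unfolding RZ using mid[of "x - m"] mid[of "x + P - m"] x n P \<beta>(2) unfolding L_def by simp
    next
      fix z assume z: "m - \<beta> + L \<le> z" "z + P + L \<le> m + ?N + \<beta>"
      then have n: "0 < n" by (rule n_pos)
      have P: "P = int n" using n by (simp add: P_def)
      \<comment> \<open>The first point from \<open>z\<close> upward that is congruent to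
        \<open>b0 + m\<close> modulo \<open>n\<close>.\<close>
      define y where "y = z + (b0 + m - z) mod int n"
      have y: "z \<le> y" "y < z + P" using n P by (auto simp: y_def)
      have "int n dvd y - m - b0"
      proof -
        have "y - m - b0 = - (b0 + m - z - (b0 + m - z) mod int n)" by (simp add: y_def)
        then show ?thesis by (simp only: dvd_minus_iff dvd_minus_mod)
      qed
      then have "y - m \<in> Z" using mid[of "y - m"] y z n b0 \<beta>(2) unfolding L_def by auto
      then show "\<exists>y\<in>R. z \<le> y \<and> y \<le> z + P" using RZ y by (intro bexI[of _ y]) auto
    qed
  qed
  moreover have "0 \<le> L" "0 < P" using \<beta>(2) by (auto simp: L_def P_def)
  ultimately show ?thesis by blast
qed

text \<open>The product of the periods and the maximum of the margins serve all types at
  once.\<close>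

lemma finite_types_regular_shape:
  assumes "finite T" "\<forall>(n, k, a, b, c)\<in>T. finite a \<and> finite b \<and> finite c"
  shows "\<exists>L P. 0 \<le> L \<and> 0 < P \<and>
    (\<forall>(n, k, a, b, c)\<in>T. \<forall>R\<in>reach_type n k a b c. R \<noteq> {} \<longrightarrow> regular_shape L P R)"
  using assms
proof (induction T rule: finite_induct)
  case empty
  show ?case by (rule exI[of _ 0], rule exI[of _ 1]) auto
next
  case (insert t T)
  obtain n k a b c where t: "t = (n, k, a, b, c)" by (metis prod_cases5)
  obtain L P where LP: "0 \<le> L" "0 < P"
    "\<forall>(n, k, a, b, c)\<in>T. \<forall>R\<in>reach_type n k a b c. R \<noteq> {} \<longrightarrow> regular_shape L P R"
    using insert by auto
  obtain L' P' where LP': "0 \<le> L'" "0 < P'"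
    "\<forall>R\<in>reach_type n k a b c. R \<noteq> {} \<longrightarrow> regular_shape L' P' R"
    using reach_type_regular_shape[of a b c n k] insert.prems t by auto
  have old: "regular_shape (max L L') (P * P') R" if "regular_shape L P R" for R
    using regular_shape_mono[OF that, of "max L L'" "P * P'"] LP LP' by simp
  have new: "regular_shape (max L L') (P * P') R" if "regular_shape L' P' R" for R
    using regular_shape_mono[OF that, of "max L L'" "P * P'"] LP LP' by simp
  show ?case
  proof (rule exI[of _ "max L L'"], rule exI[of _ "P * P'"], intro conjI)
    show "0 \<le> max L L'" "0 < P * P'" using LP LP' by auto
    show "\<forall>(n, k, a, b, c)\<in>insert t T. \<forall>R\<in>reach_type n k a b c.
        R \<noteq> {} \<longrightarrow> regular_shape (max L L') (P * P') R"
      using LP(3) LP'(3) old new t by fast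
  qed
qed

section \<open>Reachable sets as a one-counter system\<close>

definition extend :: "int set \<Rightarrow> int set \<Rightarrow> int set" where
  "extend R s = {z. 0 \<le> z \<and> (\<exists>x\<in>R. \<exists>e\<in>s. z = x + e)}"

lemma extend_empty [simp]: "extend {} s = {}"
  by (simp add: extend_def)

section \<open>Reachable sets computed step by step\<close>

lemma reachable_points_Nil [simp]: "reachable_points [] = {0}"
  by (auto simp: reachable_points_def compatible_def meander_def position_def)

lemma meander_snoc: "meander (v @ [e]) \<longleftrightarrow> meander v \<and> 0 \<le> sum_list v + e"
proof -
  have "(\<forall>k\<le>Suc (length v). 0 \<le> position (v @ [e]) k) \<longleftrightarrow>
      (\<forall>k\<le>length v. 0 \<le> position v k) \<and> 0 \<le> sum_list v + e"
    by (auto simp: position_def le_Suc_eq)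
  then show ?thesis by (simp add: meander_def)
qed

lemma reachable_points_eq:
  "reachable_points w = {sum_list v |v. list_all2 (\<in>) v w \<and> meander v}"
  by (simp add: reachable_points_def compatible_def position_def)

text \<open>A meander stays one after a further step iff the new endpoint is nonnegative. So the
  reachable set is all that a walk has to remember: it is the state of a deterministic
  automaton.\<close>

lemma reachable_points_snoc:
  "reachable_points (w @ [s]) = extend (reachable_points w) s"
proof (rule set_eqI)
  fix z
  have snoc: "list_all2 (\<in>) v (w @ [s]) \<longleftrightarrow> (\<exists>u e. v = u @ [e] \<and> list_all2 (\<in>) u w \<and> e \<in> s)"
    for v :: "int list"
  proof
    assume "\<exists>u e. v = u @ [e] \<and> list_all2 (\<in>) u w \<and> e \<in> s"
    then show "list_all2 (\<in>) v (w @ [s])" by (auto intro!: list_all2_appendI)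
  qed (auto simp: list_all2_append2 list_all2_Cons2)
  show "z \<in> reachable_points (w @ [s]) \<longleftrightarrow> z \<in> extend (reachable_points w) s"
  proof
    assume "z \<in> reachable_points (w @ [s])"
    then obtain u e where "list_all2 (\<in>) u w" "e \<in> s" "meander (u @ [e])" "z = sum_list u + e"
      unfolding reachable_points_eq snoc by auto
    then show "z \<in> extend (reachable_points w) s"
      unfolding reachable_points_eq extend_def meander_snoc by blast
  next
    assume "z \<in> extend (reachable_points w) s"
    then obtain u e where u: "list_all2 (\<in>) u w" "e \<in> s" "meander u" "z = sum_list u + e" "0 \<le> z"
      unfolding reachable_points_eq extend_def by blast
    then have "list_all2 (\<in>) (u @ [e]) (w @ [s])" "meander (u @ [e])" "z = sum_list (u @ [e])"
      unfolding snoc meander_snoc by auto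
    then show "z \<in> reachable_points (w @ [s])" unfolding reachable_points_eq by blast
  qed
qed

lemma reachable_points_foldl: "reachable_points w = foldl extend {0} w"
  by (induction w rule: rev_induct) (simp_all add: reachable_points_snoc)

lemma N_meander_iff: "N_meander S w \<longleftrightarrow> set w \<subseteq> S \<and> reachable_points w \<noteq> {}"
  by (auto simp: N_meander_def N_walk_def reachable_points_def)

lemma N_excursion_iff: "N_excursion S w \<longleftrightarrow> set w \<subseteq> S \<and> 0 \<in> reachable_points w"
  by (auto simp: N_excursion_def N_walk_def reachable_points_def excursion_def)

lemma path_weight_count:
  assumes "finite S"
  shows "path_weight \<delta> S (\<lambda>x. if Q x then 1 else 0) n x =
    of_nat (card {w. set w \<subseteq> S \<and> length w = n \<and> Q (foldl \<delta> x w)})"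
proof (induction n arbitrary: x)
  case 0
  have "{w. set w \<subseteq> S \<and> length w = 0 \<and> Q (foldl \<delta> x w)} = (if Q x then {[]} else {})" by auto
  then show ?case by simp
next
  case (Suc n)
  let ?W = "\<lambda>s. {w. set w \<subseteq> S \<and> length w = n \<and> Q (foldl \<delta> (\<delta> x s) w)}"
  have "{w. set w \<subseteq> S \<and> length w = Suc n \<and> Q (foldl \<delta> x w)} = (\<Union>s\<in>S. (#) s ` ?W s)"
    by (auto simp: length_Suc_conv)
  moreover have "card (\<Union>s\<in>S. (#) s ` ?W s) = (\<Sum>s\<in>S. card ((#) s ` ?W s))"
  proof (rule card_UN_disjoint)
    show "\<forall>s\<in>S. finite ((#) s ` ?W s)"
    proof
      fix s assume "s \<in> S"
      have "?W s \<subseteq> {w. set w \<subseteq> S \<and> length w = n}" by blast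
      then show "finite ((#) s ` ?W s)"
        using finite_lists_length_eq[OF assms, of n] finite_subset by blast
    qed
  qed (use assms in auto)
  moreover have "card ((#) s ` ?W s) = card (?W s)" for s by (intro card_image) auto
  ultimately show ?case using Suc by simp
qed

lemma N_excursion_gf_eq:
  assumes "finite S"
  shows "N_excursion_gf S =
    Abs_fps (\<lambda>n. path_weight extend S (\<lambda>R. if 0 \<in> R then 1 else 0) n {0})"
proof -
  have "{w. N_excursion S w \<and> length w = n} =
      {w. set w \<subseteq> S \<and> length w = n \<and> 0 \<in> foldl extend {0} w}" for n
    by (auto simp: N_excursion_iff reachable_points_foldl)
  then show ?thesis
    unfolding N_excursion_gf_def by (simp add: path_weight_count[OF assms])
qed

text \<open>The types enter only through a uniform margin \<open>L\<close> and period
  \<open>P\<close>; \<open>descent\<close> is the condition on the minima. \<open>D\<close> bounds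
  all steps and later serves as the unit of the counter, hence \<open>0 < D\<close>.\<close>

locale regular_walks =
  fixes S :: "int set set" and L P D :: int
  assumes finS: "finite S"
    and steps: "\<And>s. s \<in> S \<Longrightarrow> finite s"
    and descent: "\<And>s. s \<in> S \<Longrightarrow> \<exists>e\<in>s. e \<le> 0"
    and D: "\<And>s e. s \<in> S \<Longrightarrow> e \<in> s \<Longrightarrow> \<bar>e\<bar> \<le> D"
    and pos: "0 < D" "0 < P" "0 \<le> L"
    and regular: "\<And>w. set w \<subseteq> S \<Longrightarrow> reachable_points w \<noteq> {} \<Longrightarrow>
      regular_shape L P (reachable_points w)"
begin

section \<open>Smallest points and periodicity of the states\<close>

definition X :: "int set set" where
  "X = reachable_points ` {w. set w \<subseteq> S}"

lemma zero_X: "{0} \<in> X"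
  unfolding X_def by (rule image_eqI[of _ _ "[]"]) simp_all

lemma extend_X: "extend R s \<in> X" if "R \<in> X" "s \<in> S"
proof -
  from that(1) obtain w where "set w \<subseteq> S" "R = reachable_points w" unfolding X_def by blast
  then show ?thesis unfolding X_def using that(2)
    by (intro image_eqI[of _ _ "w @ [s]"]) (simp_all add: reachable_points_snoc)
qed

lemma X_induct [consumes 1, case_names zero extend]:
  assumes "R \<in> X" "Q {0}" "\<And>R s. R \<in> X \<Longrightarrow> s \<in> S \<Longrightarrow> Q R \<Longrightarrow> Q (extend R s)"
  shows "Q R"
proof -
  have "Q (reachable_points w)" if "set w \<subseteq> S" for w
    using that
  proof (induction w rule: rev_induct)
    case (snoc s w)
    then have "reachable_points w \<in> X" unfolding X_def by auto
    with snoc assms(3) show ?case by (simp add: reachable_points_snoc)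
  qed (simp add: assms(2))
  then show ?thesis using assms(1) unfolding X_def by blast
qed

lemma finite_extend: "finite (extend R s)" if "finite R" "finite s"
proof -
  have "extend R s \<subseteq> (\<lambda>(x, e). x + e) ` (R \<times> s)" by (auto simp: extend_def)
  then show ?thesis using that by (meson finite_SigmaI finite_imageI finite_subset)
qed

lemma finite_X: "finite R" if "R \<in> X"
  using that by (induction rule: X_induct) (auto intro: finite_extend steps)

lemma nonneg_X: "0 \<le> x" if "R \<in> X" "x \<in> R"
proof -
  have "\<forall>x\<in>R. 0 \<le> x" using that(1) by (induction rule: X_induct) (auto simp: extend_def)
  then show ?thesis using that(2) by blast
qed

lemma regular_X: "regular_shape L P R" if "R \<in> X" "R \<noteq> {}"
  using that regular unfolding X_def by blast

text \<open>Chosen for \<open>min_bound\<close>: a point at most \<open>D + 2 * L + P\<close> moves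
  to at most \<open>M\<close> in one step.\<close>

definition M :: int where "M = 2 * D + 2 * L + P"

text \<open>
  If the smallest points of \<open>R\<close> are lost, the next surviving one is not far since gaps are bounded.
\<close>

lemma min_bound: "\<exists>x\<in>R. x \<le> M" if "R \<in> X" "R \<noteq> {}"
  using that
proof (induction rule: X_induct)
  case zero
  then show ?case using pos by (simp add: M_def)
next
  case (extend R s)
  have ne: "R \<noteq> {}" using extend.prems by auto
  then obtain x0 where x0: "x0 \<in> R" "x0 \<le> M" using extend by blast
  \<comment> \<open>Adding \<open>e\<close> never raises a point, so a point up to \<open>M\<close>
    that is not pushed below 0 stays at most \<open>M\<close>.\<close>
  obtain e where e: "e \<in> s" "e \<le> 0" using descent extend by blast
  then have eD: "- e \<le> D" using D[of s e] extend by auto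
  have keep: ?case if "y \<in> R" "- e \<le> y" "y \<le> M" for y
    using that e by (intro bexI[of _ "y + e"]) (auto simp: extend_def)
  show ?case
  proof (cases "- e \<le> x0")
    case True
    then show ?thesis using keep x0 by blast
  next
    case False
    show ?thesis
    proof (cases "\<exists>x\<in>R. D + 2 * L + P < x")
      case True
      then obtain x1 where x1: "x1 \<in> R" "D + 2 * L + P < x1" by blast
      obtain lo hi where bounds: "\<forall>x\<in>R. lo \<le> x \<and> x \<le> hi"
        and gap: "\<forall>z. lo + L \<le> z \<longrightarrow> z + P + L \<le> hi \<longrightarrow> (\<exists>y\<in>R. z \<le> y \<and> y \<le> z + P)"
        using regular_X[OF extend(1) ne] unfolding regular_shape_def by blast
      \<comment> \<open>The interval from \<open>D + L\<close> to \<open>D + L + P\<close> lies in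
        the regular range because \<open>x0 < D\<close>; the point found there survives the
        step.\<close>
      have "lo \<le> x0" "x1 \<le> hi" using bounds x0 x1 by auto
      then have "lo + L \<le> D + L" "D + L + P + L \<le> hi" using False eD x1 by linarith+
      then obtain y where "y \<in> R" "D + L \<le> y" "y \<le> D + L + P" using gap by blast
      then show ?thesis using keep[of y] eD pos unfolding M_def by linarith
    next
      case False
      obtain z where z: "z \<in> extend R s" using extend.prems by blast
      then obtain x e' where "x \<in> R" "e' \<in> s" "z = x + e'" unfolding extend_def by blast
      then have "z \<le> M" using False D[of s e'] extend(2) unfolding M_def by force
      then show ?thesis using z by blast
    qed
  qed
qed

definition \<Lambda> :: int where "\<Lambda> = M + L + D"

lemma Lambda_bounds: "D \<le> \<Lambda>" "0 < \<Lambda>"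
  using pos by (auto simp: \<Lambda>_def M_def)

text \<open>The unknown bounds of \<open>regular_shape\<close> are traded for known ones:
  \<open>lo \<le> M\<close> by \<open>min_bound\<close>, and \<open>hi\<close> is at least
  \<open>Max R\<close>.\<close>

lemma periodic: "x \<in> R \<longleftrightarrow> x + P \<in> R"
  if R: "R \<in> X" "R \<noteq> {}" and x: "\<Lambda> \<le> x" "x + P + \<Lambda> \<le> Max R"
proof -
  obtain lo hi where bounds: "\<forall>x\<in>R. lo \<le> x \<and> x \<le> hi"
    and per: "\<forall>x. lo + L \<le> x \<longrightarrow> x + P + L \<le> hi \<longrightarrow> (x \<in> R \<longleftrightarrow> x + P \<in> R)"
    using regular_X[OF R] unfolding regular_shape_def by (elim exE conjE) (rule that)
  obtain x0 where "x0 \<in> R" "x0 \<le> M" using min_bound[OF R] by blast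
  then have "lo \<le> M" using bounds by force
  moreover have "Max R \<le> hi" using bounds finite_X[OF R(1)] R(2) by auto
  moreover have "0 \<le> M" using pos by (simp add: M_def)
  ultimately show ?thesis using x per pos unfolding \<Lambda>_def by auto
qed

section \<open>Windows, control and counter\<close>

definition W :: int where "W = \<Lambda> + P"
text \<open>\<open>W\<close> covers the margin and one full period. For a maximum of at least
  \<open>H\<close>, even the bottom window widened by one step, up to \<open>W + D\<close>, stays
  \<open>\<Lambda>\<close> below the maximum.\<close>

definition H :: int where "H = W + D + \<Lambda>"

definition bottom_part :: "int set \<Rightarrow> int set" where
  "bottom_part R = R \<inter> {0..W}"

definition top_part :: "int set \<Rightarrow> int set" where
  "top_part R = {i\<in>{0..W}. Max R - i \<in> R}"

text \<open>For \<open>H \<le> Max R\<close>, the remainder modulo \<open>D\<close> and the quotient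
  \<open>level\<close> together recover the maximum.\<close>

definition ctrl :: "int set \<Rightarrow> int set \<times> int set \<times> int" where
  "ctrl R = (bottom_part R, top_part R, (Max R - H) mod D)"

text \<open>A point beyond the window is moved down by the period \<open>P\<close> until it falls
  into the window; both sets are periodic there.\<close>

lemma bottom_part_extends:
  assumes R: "R \<in> X" "R \<noteq> {}" "Q \<in> X" "Q \<noteq> {}" and b: "bottom_part R = bottom_part Q"
    and x: "x + \<Lambda> \<le> Max R" "x + \<Lambda> \<le> Max Q"
  shows "x \<in> R \<longleftrightarrow> x \<in> Q"
  using x
proof (induction "nat x" arbitrary: x rule: less_induct)
  case less
  consider "x < 0" | "0 \<le> x" "x \<le> W" | "W < x" by linarith
  then show ?case
  proof cases
    case 1
    then show ?thesis using nonneg_X[OF R(1), of x] nonneg_X[OF R(3), of x] by auto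
  next
    case 2
    moreover have "x \<in> bottom_part R \<longleftrightarrow> x \<in> bottom_part Q" by (simp only: b)
    ultimately show ?thesis by (simp add: bottom_part_def)
  next
    case 3
    then have "x - P \<in> R \<longleftrightarrow> x - P \<in> Q"
      using pos Lambda_bounds less.prems unfolding W_def by (intro less.hyps) auto
    then show ?thesis
      using periodic[OF R(1,2), of "x - P"] periodic[OF R(3,4), of "x - P"] 3 less.prems
      unfolding W_def by simp
  qed
qed

text \<open>Points at least \<open>\<Lambda>\<close> below the maximum come from the bottom window
  by periodicity, the rest from the top window, as \<open>\<Lambda> \<le> W\<close>.\<close>

lemma ctrl_Max_determines:
  assumes R: "R \<in> X" "R \<noteq> {}" "Q \<in> X" "Q \<noteq> {}" and c: "ctrl R = ctrl Q" and m: "Max R = Max Q"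
  shows "R = Q"
proof (rule set_eqI)
  fix x
  have b: "bottom_part R = bottom_part Q" and t: "top_part R = top_part Q" using c by (auto simp: ctrl_def)
  consider "x + \<Lambda> \<le> Max R" | "Max R < x" | "Max R < x + \<Lambda>" "x \<le> Max R" by linarith
  then show "x \<in> R \<longleftrightarrow> x \<in> Q"
  proof cases
    case 1
    then show ?thesis using bottom_part_extends[OF R b] m by simp
  next
    case 2
    then have "x \<notin> R" "x \<notin> Q" using m Max_ge[OF finite_X[OF R(1)], of x] Max_ge[OF finite_X[OF R(3)], of x] by auto
    then show ?thesis by simp
  next
    case 3
    then have "Max R - x \<in> {0..W}" using pos by (simp add: W_def)
    moreover have "Max R - x \<in> top_part R \<longleftrightarrow> Max R - x \<in> top_part Q" by (simp only: t)
    ultimately show ?thesis using m by (simp add: top_part_def)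
  qed
qed

text \<open>The empty set is the dead state of walks that are not N-meanders; it counts as low
  because it has no maximum.\<close>

definition Low :: "int set set" where
  "Low = {R \<in> X. R = {} \<or> Max R < H}"

lemma high_iff: "R \<in> X - Low \<longleftrightarrow> R \<in> X \<and> R \<noteq> {} \<and> H \<le> Max R"
  by (auto simp: Low_def)

lemma Max_high_mem: "Max R \<in> R" if "R \<in> X - Low"
  using that finite_X Max_in unfolding high_iff by blast

lemma H_pos: "0 < H"
  using Lambda_bounds pos by (simp add: H_def W_def)

lemma zero_Low: "{0} \<in> Low"
  using zero_X H_pos by (simp add: Low_def)

lemma finite_Low: "finite Low"
proof (rule finite_subset)
  show "Low \<subseteq> Pow {0..H}"
  proof (intro subsetI PowI)
    fix R x assume "R \<in> Low" "x \<in> R"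
    then have R: "R \<in> X" "Max R < H" by (auto simp: Low_def)
    then show "x \<in> {0..H}" using \<open>x \<in> R\<close> nonneg_X[OF R(1)] Max_ge[OF finite_X[OF R(1)], of x] by auto
  qed
qed simp

lemma Max_step_bounds: "\<bar>Max s\<bar> \<le> D" if "s \<in> S"
  using D[OF that, of "Max s"] steps[OF that] descent[OF that] by (auto intro: Max_in)

text \<open>A maximum of at least \<open>H\<close> is too high to be pushed below 0 by one step, so
  the sum of the maxima survives.\<close>

lemma Max_extend:
  assumes R: "R \<in> X - Low" and s: "s \<in> S"
  shows "extend R s \<noteq> {}" "Max (extend R s) = Max R + Max s"
proof -
  have "Max R \<in> R" by (rule Max_high_mem[OF R])
  moreover have "Max s \<in> s" using steps[OF s] descent[OF s] by (auto intro: Max_in)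
  moreover have "0 \<le> Max R + Max s"
    using R Max_step_bounds[OF s] Lambda_bounds pos unfolding high_iff H_def W_def by auto
  ultimately have mem: "Max R + Max s \<in> extend R s" by (auto simp: extend_def)
  then show "extend R s \<noteq> {}" by blast
  have fin: "finite R" "finite s" using R s finite_X steps by auto
  show "Max (extend R s) = Max R + Max s"
  proof (rule Max_eqI[OF finite_extend[OF fin] _ mem])
    fix z assume "z \<in> extend R s"
    then obtain x e where "x \<in> R" "e \<in> s" "z = x + e" unfolding extend_def by blast
    then show "z \<le> Max R + Max s" using fin by (simp add: add_mono)
  qed
qed

text \<open>Points of the new bottom window come from points up to \<open>W + D\<close>, which the
  old one determines. Seen from the maximum, an element \<open>e\<close> increases the distance by
  \<open>Max s - e\<close>, so the new top window needs only the old one. Remainders add modulo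
  \<open>D\<close>.\<close>

lemma ctrl_extend_cong:
  assumes R: "R \<in> X - Low" "Q \<in> X - Low" and c: "ctrl R = ctrl Q" and s: "s \<in> S"
  shows "ctrl (extend R s) = ctrl (extend Q s)"
proof -
  have b: "bottom_part R = bottom_part Q" and t: "top_part R = top_part Q" and r: "(Max R - H) mod D = (Max Q - H) mod D"
    using c by (auto simp: ctrl_def)
  have RQ: "R \<in> X" "R \<noteq> {}" "H \<le> Max R" "Q \<in> X" "Q \<noteq> {}" "H \<le> Max Q" using R unfolding high_iff by auto
  have low: "x \<in> R \<longleftrightarrow> x \<in> Q" if "x \<le> W + D" for x
    using that RQ by (intro bottom_part_extends b) (auto simp: H_def)
  have "bottom_part (extend R s) = bottom_part (extend Q s)"
  proof (rule set_eqI)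
    fix z
    have *: "z \<in> bottom_part (extend U s) \<longleftrightarrow> 0 \<le> z \<and> z \<le> W \<and> (\<exists>e\<in>s. z - e \<in> U)" for U
      by (force simp: bottom_part_def extend_def)
    have "z - e \<in> R \<longleftrightarrow> z - e \<in> Q" if "e \<in> s" "z \<le> W" for e
      using D[OF s that(1)] that(2) by (intro low) auto
    then show "z \<in> bottom_part (extend R s) \<longleftrightarrow> z \<in> bottom_part (extend Q s)" unfolding * by blast
  qed
  moreover have "top_part (extend R s) = top_part (extend Q s)"
  proof -
    have *: "top_part (extend U s) = {i\<in>{0..W}. \<exists>e\<in>s. 0 \<le> i + e - Max s \<and> i + e - Max s \<in> top_part U}"
      if U: "U \<in> X - Low" for U
    proof (rule set_eqI)
      fix i
      \<comment> \<open>Since \<open>H - D - W = \<Lambda>\<close>, the new top window lies above 0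
        and the cut at 0 does not affect it.\<close>
      have "0 \<le> Max U + Max s - i" if "i \<le> W"
        using U Max_step_bounds[OF s] Lambda_bounds that unfolding high_iff H_def by auto
      then have "i \<in> top_part (extend U s) \<longleftrightarrow> 0 \<le> i \<and> i \<le> W \<and> (\<exists>e\<in>s. Max U - (i + e - Max s) \<in> U)"
        unfolding top_part_def Max_extend(2)[OF U s] by (force simp: extend_def algebra_simps)
      also have "\<dots> \<longleftrightarrow> i \<in> {i\<in>{0..W}. \<exists>e\<in>s. 0 \<le> i + e - Max s \<and> i + e - Max s \<in> top_part U}"
      proof -
        have "0 \<le> i + e - Max s \<and> i + e - Max s \<le> W"
          if "i \<le> W" "e \<in> s" "Max U - (i + e - Max s) \<in> U" for e
        proof -
          have "e \<le> Max s" using that steps[OF s] by simp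
          moreover have "Max U - (i + e - Max s) \<le> Max U" using that(3) U finite_X by (intro Max_ge) auto
          ultimately show ?thesis using that(1) by linarith
        qed
        then show ?thesis by (auto simp: top_part_def)
      qed
      finally show "i \<in> top_part (extend U s) \<longleftrightarrow>
        i \<in> {i\<in>{0..W}. \<exists>e\<in>s. 0 \<le> i + e - Max s \<and> i + e - Max s \<in> top_part U}" .
    qed
    show ?thesis unfolding *[OF R(1)] *[OF R(2)] t ..
  qed
  moreover have "(Max R + Max s - H) mod D = (Max Q + Max s - H) mod D"
  proof -
    have "(Max R - H + Max s) mod D = (Max Q - H + Max s) mod D"
      using r by (rule mod_add_cong) simp
    then show ?thesis by (simp add: algebra_simps)
  qed
  ultimately show ?thesis
    unfolding ctrl_def Max_extend(2)[OF R(1) s] Max_extend(2)[OF R(2) s] by simp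
qed

text \<open>Independent of the chosen set by \<open>ctrl_extend_cong\<close>. A control of no high
  set still gets a value of \<open>ctrl\<close>, which keeps \<open>nxt\<close> inside
  \<open>controls\<close>.\<close>

definition nxt :: "int set \<times> int set \<times> int \<Rightarrow> int set \<Rightarrow> int set \<times> int set \<times> int" where
  "nxt p s = ctrl (extend (SOME R. R \<in> X - Low \<and> ctrl R = p) s)"

lemma ctrl_extend: "ctrl (extend R s) = nxt (ctrl R) s" if "R \<in> X - Low" "s \<in> S"
proof -
  define Q where "Q = (SOME Q. Q \<in> X - Low \<and> ctrl Q = ctrl R)"
  have "Q \<in> X - Low \<and> ctrl Q = ctrl R" unfolding Q_def by (rule someI[of _ R]) (use that in simp)
  then show ?thesis using ctrl_extend_cong[of R Q s] that unfolding nxt_def Q_def[symmetric] by simp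
qed

text \<open>The carry when \<open>Max s\<close> is added to the remainder modulo
  \<open>D\<close>.\<close>

definition jump :: "int set \<times> int set \<times> int \<Rightarrow> int set \<Rightarrow> int" where
  "jump p s = (snd (snd p) + Max s) div D"

text \<open>Decodes a control after a drop, when the maximum is at least \<open>H - D\<close> but
  below \<open>H\<close>. The default \<open>{0}\<close> keeps every value in
  \<open>Low\<close>.\<close>

definition low :: "int set \<times> int set \<times> int \<Rightarrow> int set" where
  "low p = (if \<exists>R\<in>Low. R \<noteq> {} \<and> H - D \<le> Max R \<and> ctrl R = p
     then SOME R. R \<in> Low \<and> R \<noteq> {} \<and> H - D \<le> Max R \<and> ctrl R = p else {0})"

lemma low_Low: "low p \<in> Low"
proof (cases "\<exists>R. R \<in> Low \<and> R \<noteq> {} \<and> H - D \<le> Max R \<and> ctrl R = p")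
  case True
  from someI_ex[OF True] True show ?thesis unfolding low_def by (simp only: Bex_def if_True)
next
  case False
  then show ?thesis unfolding low_def using zero_Low by (simp only: Bex_def if_False)
qed

lemma low_ctrl: "low (ctrl R) = R" if R: "R \<in> Low" "R \<noteq> {}" "H - D \<le> Max R"
proof -
  define Q where "Q = (SOME Q. Q \<in> Low \<and> Q \<noteq> {} \<and> H - D \<le> Max Q \<and> ctrl Q = ctrl R)"
  have Q: "Q \<in> Low \<and> Q \<noteq> {} \<and> H - D \<le> Max Q \<and> ctrl Q = ctrl R"
    unfolding Q_def by (rule someI[of _ R]) (use R in simp)
  have shift: "(Max U - H) mod D = Max U - H + D" if "U \<in> Low" "U \<noteq> {}" "H - D \<le> Max U" for U
  proof -
    have "(Max U - H) mod D = (Max U - H + D) mod D" by simp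
    also have "\<dots> = Max U - H + D" using that by (intro mod_pos_pos_trivial) (auto simp: Low_def)
    finally show ?thesis .
  qed
  have "(Max Q - H) mod D = (Max R - H) mod D" using Q by (auto simp: ctrl_def)
  then have "Max Q = Max R" using shift[of Q] shift[of R] Q R by simp
  then have "Q = R" using Q R by (intro ctrl_Max_determines) (auto simp: Low_def)
  moreover have "low (ctrl R) = Q" unfolding low_def Q_def using R by auto
  ultimately show ?thesis by simp
qed

definition level :: "int set \<Rightarrow> nat" where
  "level R = nat ((Max R - H) div D)"

lemma high_step:
  assumes R: "R \<in> X - Low" and s: "s \<in> S"
  shows "extend R s \<in> X - Low \<and> int (level (extend R s)) = int (level R) + jump (ctrl R) s \<and>
           ctrl (extend R s) = nxt (ctrl R) s \<or>
         extend R s = low (nxt (ctrl R) s) \<and> level R = 0 \<and> jump (ctrl R) s = -1"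
proof -
  have X: "extend R s \<in> X" using extend_X R s by blast
  have HR: "H \<le> Max R" using R unfolding high_iff by blast
  then have lev: "int (level R) = (Max R - H) div D" using pos by (simp add: level_def pos_imp_zdiv_nonneg_iff)
  have split: "Max R + Max s - H = (Max R - H) mod D + Max s + (Max R - H) div D * D"
    using div_mult_mod_eq[of "Max R - H" D] by linarith
  have "(Max R + Max s - H) div D = (Max R - H) div D + ((Max R - H) mod D + Max s) div D"
    unfolding split by (rule div_mult_self1) (use pos in simp)
  then have "(Max R + Max s - H) div D = (Max R - H) div D + jump (ctrl R) s"
    by (simp add: jump_def ctrl_def)
  then have lev': "(Max (extend R s) - H) div D = int (level R) + jump (ctrl R) s"
    using Max_extend(2)[OF R s] lev by simp
  show ?thesis
  proof (cases "H \<le> Max (extend R s)")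
    case True
    then have "int (level (extend R s)) = (Max (extend R s) - H) div D"
      using pos by (simp add: level_def pos_imp_zdiv_nonneg_iff)
    moreover have "extend R s \<in> X - Low" unfolding high_iff using True X Max_extend(1)[OF R s] by blast
    ultimately show ?thesis using ctrl_extend[OF R s] lev' by simp
  next
    case False
    \<comment> \<open>One step lowers the maximum by at most \<open>D\<close>, so it lands at most
      one counter unit below \<open>H\<close>, and the counter was 0.\<close>
    have near: "H - D \<le> Max (extend R s)" "Max R < H + D"
      using Max_extend(2)[OF R s] HR False Max_step_bounds[OF s] by auto
    have "extend R s \<in> Low" using False X by (simp add: Low_def)
    then have "extend R s = low (nxt (ctrl R) s)"
      using low_ctrl[of "extend R s"] near Max_extend(1)[OF R s] ctrl_extend[OF R s] by simp
    moreover have "level R = 0" using near HR by (simp add: level_def div_pos_pos_trivial)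
    moreover have "(Max (extend R s) - H) div D = -1"
      using near False by (intro int_div_pos_eq[where r = "Max (extend R s) - H + D"]) auto
    ultimately show ?thesis using lev' by simp
  qed
qed

text \<open>A step raises the maximum by at most \<open>D\<close>, so a set leaving
  \<open>Low\<close> has its maximum below \<open>H + D\<close>.\<close>

lemma low_step:
  assumes R: "R \<in> Low" and s: "s \<in> S"
  shows "extend R s \<in> Low \<or> extend R s \<in> X - Low \<and> level (extend R s) = 0"
proof (cases "extend R s \<in> Low")
  case False
  have RX: "R \<in> X" using R by (simp add: Low_def)
  have E: "extend R s \<in> X - Low" using False extend_X[OF RX s] by simp
  then have "Max (extend R s) \<in> extend R s" by (rule Max_high_mem)
  then obtain x e where x: "x \<in> R" "e \<in> s" "Max (extend R s) = x + e" unfolding extend_def by blast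
  have "x \<le> Max R" using x finite_X[OF RX] by simp
  moreover have "Max R < H" using R x by (auto simp: Low_def)
  ultimately have "Max (extend R s) - H < D" using x D[OF s, of e] by auto
  then have "level (extend R s) = 0" using E unfolding high_iff level_def
    by (simp add: div_pos_pos_trivial)
  then show ?thesis using E by blast
qed simp

definition controls :: "(int set \<times> int set \<times> int) set" where
  "controls = Pow {0..W} \<times> Pow {0..W} \<times> {0..<D}"

lemma ctrl_controls: "ctrl R \<in> controls"
  using pos by (auto simp: ctrl_def controls_def bottom_part_def top_part_def)

theorem algebraic_N_excursion_gf: "algebraic_fps (N_excursion_gf S)"
proof -
  interpret one_counter extend S X Low controls "\<lambda>R. if 0 \<in> R then 1 else 0 :: rat" level ctrl nxt jump
    "\<lambda>p. if 0 \<in> fst p then 1 else 0" low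
  proof
    show "finite S" "finite Low" "finite controls" using finS finite_Low by (auto simp: controls_def)
    show "Low \<subseteq> X" by (auto simp: Low_def)
    show "ctrl R \<in> controls" for R by (rule ctrl_controls)
    show "nxt p s \<in> controls" for p s unfolding nxt_def by (rule ctrl_controls)
    show "jump p s \<in> {-1, 0, 1}" if "p \<in> controls" "s \<in> S" for p s
    proof -
      \<comment> \<open>A remainder below \<open>D\<close> plus a maximum of size at most
        \<open>D\<close>; in this range the carry is -1, 0 or 1.\<close>
      have "- D \<le> snd (snd p) + Max s" "snd (snd p) + Max s < 2 * D"
        using that Max_step_bounds[of s] by (auto simp: controls_def)
      moreover define q where "q = jump p s"
      moreover have "D * q + (snd (snd p) + Max s) mod D = snd (snd p) + Max s"
        unfolding q_def jump_def by simp
      moreover have "0 \<le> (snd (snd p) + Max s) mod D" "(snd (snd p) + Max s) mod D < D" using pos by auto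
      ultimately have "D * (-2) < D * q" "D * q < D * 2" by linarith+
      then have "-2 < q" "q < 2" using pos mult_less_cancel_left_pos by blast+
      then show ?thesis unfolding q_def by auto
    qed
    show "low p \<in> Low" for p by (rule low_Low)
    \<comment> \<open>Acceptance can be read off the bottom window, since 0 lies in
      \<open>{0..W}\<close>.\<close>
    show "(if 0 \<in> R then 1 else 0) = (if 0 \<in> fst (ctrl R) then 1 else 0)" for R
      using Lambda_bounds pos by (simp add: ctrl_def bottom_part_def W_def)
  qed (use high_step low_step in blast)+
  show ?thesis unfolding N_excursion_gf_eq[OF finS] by (rule algebraic_path_weight[OF zero_Low])
qed

end

section \<open>From finitely many types to regular walks\<close>

theorem theorem5p4:
  fixes S :: "int set set"
    and T :: "(nat \<times> nat \<times> int set \<times> int set \<times> int set) set"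
  assumes "finite S"
    and "\<forall>s\<in>S. N_step s"
    and "S \<noteq> {} \<longrightarrow> Max (Min ` S) \<le> 0"
    and "finite T"
    and "\<forall>(n, k, a, b, c)\<in>T. finite a \<and> finite b \<and> finite c"
    and "\<forall>w. N_meander S w \<longrightarrow> (\<exists>(n, k, a, b, c)\<in>T. reachable_points w \<in> reach_type n k a b c)"
  shows "algebraic_fps (N_excursion_gf S)"
proof -
  obtain L P where LP: "0 \<le> L" "0 < P"
    "\<forall>(n, k, a, b, c)\<in>T. \<forall>R\<in>reach_type n k a b c. R \<noteq> {} \<longrightarrow> regular_shape L P R"
    using finite_types_regular_shape[OF assms(4,5)] by blast
  \<comment> \<open>The extra element 1 makes \<open>D\<close> positive even if \<open>S\<close> is
    empty or all steps are zero.\<close>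
  define D where "D = Max (insert 1 (abs ` \<Union>S))"
  have step: "finite s" "s \<noteq> {}" if "s \<in> S" for s using assms(2) that by (auto simp: N_step_def)
  have fin: "finite (insert 1 (abs ` \<Union>S))" using assms(1) step by blast
  have "regular_walks S L P D"
  proof
    show "finite S" by (rule assms(1))
    show "finite s" if "s \<in> S" for s by (rule step[OF that])
    show "\<exists>e\<in>s. e \<le> 0" if "s \<in> S" for s
    proof
      show "Min s \<in> s" using step[OF that] by (rule Min_in)
      have "Min s \<le> Max (Min ` S)" using assms(1) that by simp
      then show "Min s \<le> 0" using assms(3) that by force
    qed
    show "\<bar>e\<bar> \<le> D" if "s \<in> S" "e \<in> s" for s e
      unfolding D_def using that by (intro Max_ge[OF fin]) blast
    have "1 \<le> D" unfolding D_def by (intro Max_ge[OF fin]) simp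
    then show "0 < D" by simp
    show "0 < P" "0 \<le> L" by (rule LP)+
    show "regular_shape L P (reachable_points w)" if "set w \<subseteq> S" "reachable_points w \<noteq> {}" for w
    proof -
      \<comment> \<open>A nonempty reachable set makes the walk an N-meander, so one of the types
        applies.\<close>
      have "N_meander S w" using that by (simp add: N_meander_iff)
      then obtain t where t: "t \<in> T" "case t of (n, k, a, b, c) \<Rightarrow> reachable_points w \<in> reach_type n k a b c"
        using assms(6) by blast
      from bspec[OF LP(3) t(1)] t(2) that(2) show ?thesis by (auto split: prod.splits)
    qed
  qed
  then show ?thesis by (rule regular_walks.algebraic_N_excursion_gf)
qed

end
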